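(* Consider the finite-difference scheme on the infinite mesh $$C_\theta[\rho_h]\,\bar\partial_tU^m+\mathcal A_hU^{(\sigma)\,m}=F^m\ \text{ on }\omega_{h,\infty},\ m\ge1;\qquad U_0^m=0,\ m\ge1;\qquad U^0=U_h^0\ \text{ on }\bar\omega_{h,\infty}.$$ Let $F=F^{(0)}+\widehat\partial_xF^{(1)}$ with $F^{(0)\,m}\in H_h$ and $F^{(1)\,m}\in\widetilde H_h$ for any $m\ge1$, and let $U_h^0\in H_h$. Then, for $\sigma\ge0$ and $\theta\le\frac14$, there exists a unique solution with $U^m\in H_h$ for all $m\ge0$; and, for $\sigma\ge\frac12$ and $\theta<\frac14$, the bound $$\max\Bigl\{\max_{0\le m\le M}\|U^m\|_{C_\theta[\rho_h],\infty},\ \sqrt2\,\|U\|_{(1),\infty}\Bigr\}\le\|U_h^0\|_{C_\theta[\rho_h],\infty}+\frac{K_\sigma}{\sqrt{c_\theta\underline\rho}}\sum_{m=1}^M\|F^{(0)\,m}\|_{H_h}\tau_m+\sqrt{\frac2\nu}\,\Bigl(\sum_{m=1}^M\|F^{(1)\,m}\|_{\widetilde H_h}^2\tau_m\Bigr)^{1/2}$$ holds for any $M\ge1$, where $K_\sigma=2(\sigma+|1-\sigma|)$, $c_\theta=1-4\max\{\theta,0\}$ and $$\|U\|_{(1),\infty}^2=\sum_{m=1}^M(\sigma-\tfrac12)\tau_m\|\bar\partial_tU^m\|_{C_\theta[\rho_h],\infty}^2\tau_m+\sum_{m=1}^M\|U^{(\sigma)\,m}\|^2_{\mathcal L_{H_{h\theta}}}\tau_m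 .$$ The bound holds also for $\theta=\frac14$ provided that $F^{(0)}=0$ (the summand with $F^{(0)}$ being dropped).
   Context: All mesh functions are real-valued; $\sigma,\theta$ are real parameters. Coefficients: $\rho,b,c$ are continuous with $\rho(x)\ge\underline\rho>0$, $b(x)\ge\nu>0$, $c(x)\ge 0$ for $x>0$, and for some $X_0>0$: $\rho(x)=\rho_\infty>0$, $b(x)=b_\infty>0$, $c(x)=c_\infty\ge0$ for $x\ge X_0$. Fix $X>X_0$. Meshes: $\bar\omega_{h,\infty}$ has nodes $0=x_0<x_1<\dots<x_J=X<\dots$ with steps $h_j=x_j-x_{j-1}$, $h_J\le X-X_0$, $h_j=h:=h_J$ for $j\ge J$; $x_{j-1/2}=\frac{x_{j-1}+x_j}2$, $h_{j+1/2}=\frac{h_j+h_{j+1}}2$; $\omega_{h,\infty}=\bar\omega_{h,\infty}\setminus\{0\}$. In time: $0=t_0<t_1<\dots$, $t_m\to\infty$, $\tau_m=t_m-t_{m-1}$. Mesh coefficients: $\rho_{hj}=\rho(x_{j-1/2})$, $b_{hj}=b(x_{j-1/2})$, $c_{hj}=c(x_{j-1/2})$, $j\ge1$. Operators: $\bar\partial_xW_j=\frac{W_j-W_{j-1}}{h_j}$, $\widehat\partial_xW_j=\frac{W_{j+1}-W_j}{h_{j+1/2}}$, $\widehat s_xW_j=\frac{h_j}{2h_{j+1/2}}W_j+\frac{h_{j+1}}{2h_{j+1/2}}W_{j+1}$, $$C_\theta[\varkappa_h]W_j=\theta\tfrac{h_j}{h_{j+1/2}}\varkappa_{hj}W_{j-1}+(1-2\theta)(\widehat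 s_x\varkappa_{hj})W_j+\theta\tfrac{h_{j+1}}{h_{j+1/2}}\varkappa_{h,j+1}W_{j+1},$$ $\mathcal A_hW=-\widehat\partial_x(b_h\bar\partial_xW)+C_\theta[c_h]W$. In time: $\bar\partial_t\Phi^m=\frac{\Phi^m-\Phi^{m-1}}{\tau_m}$, $\Phi^{(\sigma)\,m}=\sigma\Phi^m+(1-\sigma)\Phi^{m-1}$. Spaces: $H_h$ is the Hilbert space of functions $W$ on $\bar\omega_{h,\infty}$ with $W_0=0$ and $\sum_{j\ge1}W_j^2<\infty$, with inner product $(V,W)_{H_h}=\sum_{j=1}^\infty V_jW_jh_{j+1/2}$; $\widetilde H_h$ is the Hilbert space of functions $W$ on $\omega_{h,\infty}$ with $\sum_{j\ge1}W_j^2<\infty$, with inner product $(V,W)_{\widetilde H_h}=\sum_{j=1}^\infty V_jW_jh_j$. Norms: for $\theta\le\frac14$, $W\in H_h$: $\|W\|_{C_\theta[\rho_h],\infty}=(C_\theta[\rho_h]W,W)_{H_h}^{1/2}$, and $\|W\|_{\mathcal L_{H_{h\theta}}}=\mathcal L_{H_{h\theta}}^{1/2}(W,W)$ with $\mathcal L_{H_{h\theta}}(V,W)=(b_h\bar\partial_xV,\bar\partial_xW)_{\widetilde H_h}+(C_\theta[c_h]V,W)_{H_h}$.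
   Formalization: Existence of a solution is asserted for σ≥0, θ≤1/4 except σ=0, θ=1/4, where it fails (e.g. x_j=j, τ_m=1, ρ=b=1, c=0, U_h^0=0, F^(1)=0, F^(0) equal to 1 at j=1 and 0 elsewhere); uniqueness and both bounds are kept on the full stated ranges. *)

theory Defs
  imports Complex_Main
begin

text \<open>
  Mesh functions are sequences indexed by the node number, and the spatial operators matter only
  at \<open>j \<ge> 1\<close>.  A function on the mesh without its origin is also a sequence; its value at
  index \<open>0\<close> is arbitrary and never used.  Sums over \<open>j \<ge> 1\<close> are series in \<open>Suc j\<close>.
\<close>

definition step :: "(nat \<Rightarrow> real) \<Rightarrow> nat \<Rightarrow> real" where
  "step x j = x j - x (j - 1)"

text \<open>\<open>step_half x j\<close> is \<open>h\<^bsub>j+1/2\<^esub>\<close>, whereas \<open>midpt x j\<close> is \<open>x\<^bsub>j-1/2\<^esub>\<close>.\<close>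

definition step_half :: "(nat \<Rightarrow> real) \<Rightarrow> nat \<Rightarrow> real" where
  "step_half x j = (step x j + step x (j + 1)) / 2"

definition midpt :: "(nat \<Rightarrow> real) \<Rightarrow> nat \<Rightarrow> real" where
  "midpt x j = (x (j - 1) + x j) / 2"

definition mesh_coeff :: "(nat \<Rightarrow> real) \<Rightarrow> (real \<Rightarrow> real) \<Rightarrow> nat \<Rightarrow> real" where
  "mesh_coeff x k j = k (midpt x j)"

definition dx_bar :: "(nat \<Rightarrow> real) \<Rightarrow> (nat \<Rightarrow> real) \<Rightarrow> nat \<Rightarrow> real" where
  "dx_bar x W j = (W j - W (j - 1)) / step x j"

definition dx_hat :: "(nat \<Rightarrow> real) \<Rightarrow> (nat \<Rightarrow> real) \<Rightarrow> nat \<Rightarrow> real" where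
  "dx_hat x W j = (W (j + 1) - W j) / step_half x j"

definition sx_hat :: "(nat \<Rightarrow> real) \<Rightarrow> (nat \<Rightarrow> real) \<Rightarrow> nat \<Rightarrow> real" where
  "sx_hat x W j = step x j / (2 * step_half x j) * W j
     + step x (j + 1) / (2 * step_half x j) * W (j + 1)"

definition C_op :: "(nat \<Rightarrow> real) \<Rightarrow> real \<Rightarrow> (nat \<Rightarrow> real) \<Rightarrow> (nat \<Rightarrow> real) \<Rightarrow> nat \<Rightarrow> real" where
  "C_op x \<theta> k W j =
     \<theta> * (step x j / step_half x j) * k j * W (j - 1)
     + (1 - 2 * \<theta>) * sx_hat x k j * W j
     + \<theta> * (step x (j + 1) / step_half x j) * k (j + 1) * W (j + 1)"

definition A_op :: "(nat \<Rightarrow> real) \<Rightarrow> real \<Rightarrow> (nat \<Rightarrow> real) \<Rightarrow> (nat \<Rightarrow> real)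
    \<Rightarrow> (nat \<Rightarrow> real) \<Rightarrow> nat \<Rightarrow> real" where
  "A_op x \<theta> bh ch W j =
     - dx_hat x (\<lambda>i. bh i * dx_bar x W i) j + C_op x \<theta> ch W j"

definition dt_bar :: "(nat \<Rightarrow> real) \<Rightarrow> (nat \<Rightarrow> nat \<Rightarrow> real) \<Rightarrow> nat \<Rightarrow> nat \<Rightarrow> real" where
  "dt_bar t U m j = (U m j - U (m - 1) j) / step t m"

definition t_avg :: "real \<Rightarrow> (nat \<Rightarrow> nat \<Rightarrow> real) \<Rightarrow> nat \<Rightarrow> nat \<Rightarrow> real" where
  "t_avg \<sigma> U m j = \<sigma> * U m j + (1 - \<sigma>) * U (m - 1) j"

definition H_space :: "(nat \<Rightarrow> real) set" where
  "H_space = {W. W 0 = 0 \<and> summable (\<lambda>j. (W (Suc j))\<^sup>2)}"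

definition Ht_space :: "(nat \<Rightarrow> real) set" where
  "Ht_space = {W. summable (\<lambda>j. (W (Suc j))\<^sup>2)}"

definition inner_H :: "(nat \<Rightarrow> real) \<Rightarrow> (nat \<Rightarrow> real) \<Rightarrow> (nat \<Rightarrow> real) \<Rightarrow> real" where
  "inner_H x V W = (\<Sum>j. V (Suc j) * W (Suc j) * step_half x (Suc j))"

definition inner_Ht :: "(nat \<Rightarrow> real) \<Rightarrow> (nat \<Rightarrow> real) \<Rightarrow> (nat \<Rightarrow> real) \<Rightarrow> real" where
  "inner_Ht x V W = (\<Sum>j. V (Suc j) * W (Suc j) * step x (Suc j))"

definition norm_H :: "(nat \<Rightarrow> real) \<Rightarrow> (nat \<Rightarrow> real) \<Rightarrow> real" where
  "norm_H x W = sqrt (inner_H x W W)"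

definition norm_Ht :: "(nat \<Rightarrow> real) \<Rightarrow> (nat \<Rightarrow> real) \<Rightarrow> real" where
  "norm_Ht x W = sqrt (inner_Ht x W W)"

definition norm_C :: "(nat \<Rightarrow> real) \<Rightarrow> real \<Rightarrow> (nat \<Rightarrow> real) \<Rightarrow> (nat \<Rightarrow> real) \<Rightarrow> real" where
  "norm_C x \<theta> \<rho>h W = sqrt (inner_H x (C_op x \<theta> \<rho>h W) W)"

definition L_form :: "(nat \<Rightarrow> real) \<Rightarrow> real \<Rightarrow> (nat \<Rightarrow> real) \<Rightarrow> (nat \<Rightarrow> real)
    \<Rightarrow> (nat \<Rightarrow> real) \<Rightarrow> (nat \<Rightarrow> real) \<Rightarrow> real" where
  "L_form x \<theta> bh ch V W =
     inner_Ht x (\<lambda>j. bh j * dx_bar x V j) (dx_bar x W) + inner_H x (C_op x \<theta> ch V) W"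

definition norm_L :: "(nat \<Rightarrow> real) \<Rightarrow> real \<Rightarrow> (nat \<Rightarrow> real) \<Rightarrow> (nat \<Rightarrow> real)
    \<Rightarrow> (nat \<Rightarrow> real) \<Rightarrow> real" where
  "norm_L x \<theta> bh ch W = sqrt (L_form x \<theta> bh ch W W)"

definition norm_1 :: "(nat \<Rightarrow> real) \<Rightarrow> (nat \<Rightarrow> real) \<Rightarrow> real \<Rightarrow> real \<Rightarrow> (nat \<Rightarrow> real)
    \<Rightarrow> (nat \<Rightarrow> real) \<Rightarrow> (nat \<Rightarrow> real) \<Rightarrow> nat \<Rightarrow> (nat \<Rightarrow> nat \<Rightarrow> real) \<Rightarrow> real" where
  "norm_1 x t \<sigma> \<theta> \<rho>h bh ch M U = sqrt (
     (\<Sum>m=1..M. (\<sigma> - 1 / 2) * step t m * (norm_C x \<theta> \<rho>h (dt_bar t U m))\<^sup>2 * step t m)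
     + (\<Sum>m=1..M. (norm_L x \<theta> bh ch (t_avg \<sigma> U m))\<^sup>2 * step t m))"

definition K_const :: "real \<Rightarrow> real" where
  "K_const \<sigma> = 2 * (\<sigma> + \<bar>1 - \<sigma>\<bar>)"

definition c_const :: "real \<Rightarrow> real" where
  "c_const \<theta> = 1 - 4 * max \<theta> 0"

definition scheme_solution :: "(nat \<Rightarrow> real) \<Rightarrow> (nat \<Rightarrow> real) \<Rightarrow> real \<Rightarrow> real \<Rightarrow> (nat \<Rightarrow> real)
    \<Rightarrow> (nat \<Rightarrow> real) \<Rightarrow> (nat \<Rightarrow> real) \<Rightarrow> (nat \<Rightarrow> nat \<Rightarrow> real) \<Rightarrow> (nat \<Rightarrow> real)
    \<Rightarrow> (nat \<Rightarrow> nat \<Rightarrow> real) \<Rightarrow> bool" where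
  "scheme_solution x t \<sigma> \<theta> \<rho>h bh ch F U0 U \<longleftrightarrow>
     (\<forall>m\<ge>1. \<forall>j\<ge>1. C_op x \<theta> \<rho>h (dt_bar t U m) j + A_op x \<theta> bh ch (t_avg \<sigma> U m) j = F m j)
     \<and> (\<forall>m\<ge>1. U m 0 = 0)
     \<and> U 0 = U0"

end

theory Submission
  imports Defs "HOL-Analysis.Convex" "HOL-Analysis.L2_Norm"
begin

text \<open>
  The scheme becomes transparent once every spatial operator is multiplied by
  \<open>h\<^bsub>j+1/2\<^esub>\<close> and read as a sum over mesh cells: the cell between nodes \<open>j - 1\<close> and \<open>j\<close>
  contributes a symmetric \<open>2 \<times> 2\<close> matrix with diagonal entries \<open>d\<^sub>j\<close> and off-diagonal entries
  \<open>e\<^sub>j\<close>.  The averaging operator has \<open>d = (1/2 - \<theta>) h k\<close>, \<open>e = \<theta> h k\<close>, and the second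
  difference has \<open>d = b / h\<close>, \<open>e = - b / h\<close>.  Summation by parts on the infinite mesh
  (\<open>suminf_cell_op\<close>) turns the nodal sums into sums of cell energies
  \<open>(d + e)/2 (u + v)\<^sup>2 + (d - e)/2 (u - v)\<^sup>2\<close>, so positivity, comparison and coercivity of all the
  forms involved reduce to inequalities between the coefficients of one cell.  The condition
  \<open>\<theta> \<le> 1/4\<close> says exactly that \<open>\<bar>e\<bar> \<le> d\<close> for the averaging operator with positive weight.

  Existence.  One time step is a system with cell matrices \<open>C / \<tau> + \<sigma> A\<close>.  These are bounded, and
  their smallest eigenvalue \<open>d - \<bar>e\<bar>\<close> is bounded away from zero: if \<open>\<theta> < 1/4\<close>, then the averaging part
  alone achieves this; if \<open>\<theta> = 1/4\<close>, then that part degenerates on oscillating functions, where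
  \<open>\<sigma> A\<close> with \<open>\<sigma> > 0\<close> takes over (\<open>step_coeffs_coercive\<close>).  A bounded coercive system on
  \<open>\<ell>\<^sup>2\<close> is solved by a Neumann series (\<open>coercive_cell_system_solvable\<close>).

  Uniqueness holds because the cell energies are nonnegative and \<open>d > 0\<close>: if they all vanish,
  then \<open>W\<^sub>0 = 0\<close> propagates from cell to cell (\<open>cell_form_eq_0_imp_zero\<close>).

  The bound.  Testing a time step with \<open>U\<^sup>(\<^sup>\<sigma>\<^sup>)\<close> gives an exact energy identity, which telescopes to
  \<open>\<parallel>U\<^sup>m\<parallel>\<^sup>2 + 2 E\<^sub>m = \<parallel>U\<^sup>0\<parallel>\<^sup>2 + 2 \<Sum> (F0, U\<^sup>(\<^sup>\<sigma>\<^sup>)) \<tau> - 2 \<Sum> (F1, \<partial>U\<^sup>(\<^sup>\<sigma>\<^sup>)) \<tau>\<close>, where \<open>E\<^sub>m\<close> is the squared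
  energy norm of the first \<open>m\<close> steps.  Let \<open>Y\<close> be the maximum of the \<open>\<parallel>U\<^sup>m\<parallel>\<close>, let
  \<open>Q = sqrt (2 E\<^sub>M)\<close> and \<open>N = max Y Q\<close>.  The \<open>F0\<close> work is at most \<open>p Y\<close> and the \<open>F1\<close> work at most
  \<open>g Q\<close>, with \<open>p\<close> and \<open>g\<close> the two source terms of the bound.  Reading the identity at the time where
  \<open>Y\<close> is attained, or at the final time, gives
  \<open>N\<^sup>2 \<le> \<parallel>U\<^sup>0\<parallel>\<^sup>2 + p Y + g Q \<le> (\<parallel>U\<^sup>0\<parallel> + p + g) N\<close>, and \<open>N\<close> cancels.
\<close>

section \<open>Square-summable sequences\<close>

text \<open>
  The sequences are summed from index \<open>0\<close>: a single term does not affect summability, and on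
  \<open>H_space\<close> the term at \<open>0\<close> vanishes.
\<close>

definition square_summable :: "(nat \<Rightarrow> real) \<Rightarrow> bool" where
  "square_summable f \<longleftrightarrow> summable (\<lambda>j. (f j)\<^sup>2)"

lemma H_space_iff: "W \<in> H_space \<longleftrightarrow> W 0 = 0 \<and> square_summable W"
  unfolding H_space_def square_summable_def
  using summable_Suc_iff[of "\<lambda>j. (W j)\<^sup>2"] by auto

lemma Ht_space_iff: "W \<in> Ht_space \<longleftrightarrow> square_summable W"
  unfolding Ht_space_def square_summable_def
  using summable_Suc_iff[of "\<lambda>j. (W j)\<^sup>2"] by auto

lemma square_summable_Suc [simp]: "square_summable (\<lambda>j. f (Suc j)) \<longleftrightarrow> square_summable f"
  unfolding square_summable_def using summable_Suc_iff[of "\<lambda>j. (f j)\<^sup>2"] by auto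

lemma summable_mult_square_summable:
  assumes "square_summable f" "square_summable g"
  shows "summable (\<lambda>j. f j * g j)"
proof (rule summable_comparison_test')
  show "summable (\<lambda>j. (f j)\<^sup>2 + (g j)\<^sup>2)"
    using assms unfolding square_summable_def by (rule summable_add)
  have "\<bar>u * v\<bar> \<le> u\<^sup>2 + v\<^sup>2" for u v :: real
    using sum_squares_bound[of "\<bar>u\<bar>" "\<bar>v\<bar>"] mult_nonneg_nonneg[of "\<bar>u\<bar>" "\<bar>v\<bar>"]
    unfolding abs_mult power2_abs by linarith
  then show "norm (f j * g j) \<le> (f j)\<^sup>2 + (g j)\<^sup>2" for j
    by simp
qed

lemma square_summable_add:
  assumes "square_summable f" "square_summable g"
  shows "square_summable (\<lambda>j. f j + g j)"
proof -
  have "summable (\<lambda>j. (f j)\<^sup>2 + (g j)\<^sup>2 + 2 * (f j * g j))"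
    using assms summable_mult_square_summable[OF assms] unfolding square_summable_def
    by (intro summable_add summable_mult)
  then show ?thesis
    unfolding square_summable_def by (simp only: power2_sum mult.assoc)
qed

lemma square_summable_Bseq_mult:
  assumes "Bseq k" "square_summable f"
  shows "square_summable (\<lambda>j. k j * f j)"
proof -
  obtain B where B: "\<And>j. \<bar>k j\<bar> \<le> B"
    using assms(1) unfolding Bseq_def by auto
  show ?thesis
    unfolding square_summable_def
  proof (rule summable_comparison_test')
    show "summable (\<lambda>j. B\<^sup>2 * (f j)\<^sup>2)"
      using assms(2) unfolding square_summable_def by (rule summable_mult)
    show "norm ((k j * f j)\<^sup>2) \<le> B\<^sup>2 * (f j)\<^sup>2" for j
      using power_mono[OF B[of j], of 2] by (simp add: power_mult_distrib mult_right_mono)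
  qed
qed

lemma square_summable_cmult: "square_summable f \<Longrightarrow> square_summable (\<lambda>j. a * f j)"
  by (rule square_summable_Bseq_mult) auto

lemma square_summable_diff:
  assumes "square_summable f" "square_summable g"
  shows "square_summable (\<lambda>j. f j - g j)"
  using square_summable_add[OF assms(1) square_summable_cmult[OF assms(2), of "-1"]] by simp

lemma square_summable_pred:
  assumes "square_summable f"
  shows "square_summable (\<lambda>j. f (j - 1))"
  using assms square_summable_Suc[of "\<lambda>j. f (j - 1)"] by simp

lemma H_space_lincomb:
  assumes "V \<in> H_space" "W \<in> H_space"
  shows "(\<lambda>j. p * V j + q * W j) \<in> H_space"
  using assms by (simp add: H_space_iff square_summable_add square_summable_cmult)

lemma Bseq_plus:
  fixes f g :: "nat \<Rightarrow> real"
  assumes "Bseq f" "Bseq g"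
  shows "Bseq (\<lambda>j. f j + g j)"
proof -
  obtain K L where "\<And>j. \<bar>f j\<bar> \<le> K" "\<And>j. \<bar>g j\<bar> \<le> L"
    using assms unfolding Bseq_def by auto
  then have "\<And>j. norm (f j + g j) \<le> K + L"
    by (metis abs_triangle_ineq add_mono order_trans real_norm_def)
  then show ?thesis
    by (rule BseqI')
qed

lemma Bseq_cmult: "Bseq f \<Longrightarrow> Bseq (\<lambda>j. a * f j :: real)"
  using Bseq_mult[of "\<lambda>_. a" f] by simp

text \<open>
  Passing to the limit in the finite Cauchy-Schwarz inequality.  The squares are written as products
  so that the right-hand side has the shape of the norms induced by \<open>inner_H\<close> and \<open>inner_Ht\<close>.
\<close>

lemma weighted_Cauchy_Schwarz_suminf:
  assumes "square_summable f" "square_summable g" "Bseq w" "\<And>j. 0 \<le> w j"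
  shows "\<bar>\<Sum>j. f j * g j * w j\<bar> \<le> sqrt (\<Sum>j. f j * f j * w j) * sqrt (\<Sum>j. g j * g j * w j)"
proof -
  have sm: "summable (\<lambda>j. p j * q j * w j)" if "square_summable p" "square_summable q" for p q
    using summable_mult_square_summable[OF that(1) square_summable_Bseq_mult[OF assms(3) that(2)]]
    by (simp add: mult_ac)
  have "\<bar>\<Sum>j<n. f j * g j * w j\<bar>
      \<le> sqrt (\<Sum>j. f j * f j * w j) * sqrt (\<Sum>j. g j * g j * w j)" for n
  proof -
    have "(\<Sum>j<n. f j * g j * w j)\<^sup>2 = (\<Sum>j<n. (f j * sqrt (w j)) * (g j * sqrt (w j)))\<^sup>2"
      using assms(4) by (simp add: mult_ac)
    also have "\<dots> \<le> (\<Sum>j<n. (f j * sqrt (w j))\<^sup>2) * (\<Sum>j<n. (g j * sqrt (w j))\<^sup>2)"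
      by (rule Cauchy_Schwarz_ineq_sum)
    also have "\<dots> = (\<Sum>j<n. f j * f j * w j) * (\<Sum>j<n. g j * g j * w j)"
      using assms(4) by (simp add: power_mult_distrib power2_eq_square mult_ac)
    also have "\<dots> \<le> (\<Sum>j. f j * f j * w j) * (\<Sum>j. g j * g j * w j)"
      by (intro mult_mono sum_le_suminf suminf_nonneg sum_nonneg sm assms mult_nonneg_nonneg
          zero_le_square) auto
    finally show ?thesis
      unfolding real_sqrt_mult[symmetric] by (intro real_le_rsqrt) (simp only: power2_abs)
  qed
  moreover have "(\<lambda>n. \<bar>\<Sum>j<n. f j * g j * w j\<bar>) \<longlonglongrightarrow> \<bar>\<Sum>j. f j * g j * w j\<bar>"
    by (intro tendsto_rabs summable_LIMSEQ sm assms)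
  ultimately show ?thesis
    by (intro LIMSEQ_le_const2) auto
qed

section \<open>Operators assembled from symmetric cell matrices\<close>

text \<open>
  Cell \<open>j\<close> lies between the nodes \<open>j - 1\<close> and \<open>j\<close> and carries the matrix with \<open>d j\<close> on the
  diagonal and \<open>e j\<close> off it.  Node \<open>j\<close> collects a row of the matrix of cell \<open>j\<close> and a row of that of
  cell \<open>j + 1\<close>.
\<close>

definition cell_op :: "(nat \<Rightarrow> real) \<Rightarrow> (nat \<Rightarrow> real) \<Rightarrow> (nat \<Rightarrow> real) \<Rightarrow> nat \<Rightarrow> real" where
  "cell_op d e W j = (d j + d (j + 1)) * W j + e j * W (j - 1) + e (j + 1) * W (j + 1)"

definition cell_form :: "(nat \<Rightarrow> real) \<Rightarrow> (nat \<Rightarrow> real) \<Rightarrow> (nat \<Rightarrow> real) \<Rightarrow> (nat \<Rightarrow> real) \<Rightarrow> real" where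
  "cell_form d e V W = (\<Sum>j. d (Suc j) * (V (Suc j) * W (Suc j) + V j * W j)
     + e (Suc j) * (V (Suc j) * W j + V j * W (Suc j)))"

lemma summable_cell_form:
  assumes "Bseq d" "Bseq e" "square_summable V" "square_summable W"
  shows "summable (\<lambda>j. d (Suc j) * (V (Suc j) * W (Suc j) + V j * W j)
     + e (Suc j) * (V (Suc j) * W j + V j * W (Suc j)))"
proof -
  have B: "Bseq (\<lambda>j. d (Suc j))" "Bseq (\<lambda>j. e (Suc j))"
    using assms by (simp_all add: Bseq_Suc_iff)
  have S: "summable (\<lambda>j. k j * (p j * q j))"
    if "Bseq k" "square_summable p" "square_summable q" for k p q
    using summable_mult_square_summable[OF square_summable_Bseq_mult[OF that(1,2)] that(3)]
    by (simp add: mult_ac)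
  show ?thesis
    unfolding distrib_left by (intro summable_add S B) (simp_all add: assms)
qed

text \<open>
  Summation by parts.  Each cell contributes \<open>a\<close> to its right node and \<open>z\<close> to its left node;
  regrouping the nodal sum by cells shifts the second family of terms by one, and the extra term at
  the boundary node drops out because the test function vanishes there.
\<close>

lemma suminf_nodal_eq_suminf_cell:
  fixes a z V :: "nat \<Rightarrow> real"
  assumes "V 0 = 0" "summable (\<lambda>j. V (Suc j) * a (Suc j))" "summable (\<lambda>j. V j * z (Suc j))"
  shows "(\<Sum>j. V (Suc j) * (a (Suc j) + z (Suc (Suc j))))
       = (\<Sum>j. V (Suc j) * a (Suc j) + V j * z (Suc j))"
proof -
  have s: "summable (\<lambda>j. V (Suc j) * z (Suc (Suc j)))"
    using assms(3) summable_Suc_iff[of "\<lambda>j. V j * z (Suc j)"] by simp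
  have "(\<Sum>j. V (Suc j) * z (Suc (Suc j))) = (\<Sum>j. V j * z (Suc j))"
    using suminf_split_head[OF assms(3)] assms(1) by simp
  then show ?thesis
    by (simp add: distrib_left flip: suminf_add[OF assms(2) s] suminf_add[OF assms(2,3)])
qed

lemma suminf_cell_op:
  assumes "Bseq d" "Bseq e" "V \<in> H_space" "square_summable W"
  shows "(\<Sum>j. V (Suc j) * cell_op d e W (Suc j)) = cell_form d e V W"
proof -
  have V: "V 0 = 0" "square_summable V" "square_summable (\<lambda>j. V (Suc j))"
    using assms by (auto simp: H_space_iff)
  have W: "square_summable (\<lambda>j. W (Suc j))"
    using assms by simp
  have B: "Bseq (\<lambda>j. d (Suc j))" "Bseq (\<lambda>j. e (Suc j))"
    using assms by (simp_all add: Bseq_Suc_iff)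
  have sq: "square_summable (\<lambda>j. d (Suc j) * W (Suc j) + e (Suc j) * W j)"
           "square_summable (\<lambda>j. d (Suc j) * W j + e (Suc j) * W (Suc j))"
    by (intro square_summable_add square_summable_Bseq_mult B W assms(4))+
  have "(\<Sum>j. V (Suc j) * cell_op d e W (Suc j))
     = (\<Sum>j. V (Suc j) * ((d (Suc j) * W (Suc j) + e (Suc j) * W (Suc j - 1))
         + (d (Suc (Suc j)) * W (Suc (Suc j) - 1) + e (Suc (Suc j)) * W (Suc (Suc j)))))"
    by (simp add: cell_op_def algebra_simps)
  also have "\<dots> = (\<Sum>j. V (Suc j) * (d (Suc j) * W (Suc j) + e (Suc j) * W (Suc j - 1))
       + V j * (d (Suc j) * W (Suc j - 1) + e (Suc j) * W (Suc j)))"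
    using suminf_nodal_eq_suminf_cell[of V "\<lambda>j. d j * W j + e j * W (j - 1)"
        "\<lambda>j. d j * W (j - 1) + e j * W j"] V(1)
        summable_mult_square_summable[OF V(3) sq(1)] summable_mult_square_summable[OF V(2) sq(2)]
    by simp
  also have "\<dots> = cell_form d e V W"
    unfolding cell_form_def by (simp add: algebra_simps)
  finally show ?thesis .
qed

lemma square_summable_cell_op:
  assumes "Bseq d" "Bseq e" "square_summable W"
  shows "square_summable (cell_op d e W)"
proof -
  have "Bseq (\<lambda>j. d (j + 1))" "Bseq (\<lambda>j. e (j + 1))"
    using assms by (simp_all add: Bseq_Suc_iff)
  then show ?thesis
    unfolding cell_op_def
    by (intro square_summable_add square_summable_Bseq_mult Bseq_plus assms square_summable_pred)
       (use assms in auto)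
qed

lemma cell_op_lincomb:
  "cell_op d e (\<lambda>i. p * V i + q * W i) j = p * cell_op d e V j + q * cell_op d e W j"
  by (simp add: cell_op_def algebra_simps)

lemma cell_op_coeff_lincomb:
  "cell_op (\<lambda>i. p * d i + q * d' i) (\<lambda>i. p * e i + q * e' i) W j
   = p * cell_op d e W j + q * cell_op d' e' W j"
  by (simp add: cell_op_def algebra_simps)

lemma cell_form_sym: "cell_form d e V W = cell_form d e W V"
  unfolding cell_form_def by (simp add: algebra_simps)

lemma cell_form_lincomb_left:
  assumes "Bseq d" "Bseq e" "square_summable V" "square_summable V'" "square_summable W"
  shows "cell_form d e (\<lambda>i. p * V i + q * V' i) W = p * cell_form d e V W + q * cell_form d e V' W"
  using summable_cell_form[OF assms(1,2,3,5)] summable_cell_form[OF assms(1,2,4,5)]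
  unfolding cell_form_def
  by (simp add: suminf_mult[symmetric] suminf_add summable_mult) (simp add: algebra_simps)

lemma cell_form_coeff_lincomb:
  assumes "Bseq d" "Bseq e" "Bseq d'" "Bseq e'" "square_summable V" "square_summable W"
  shows "cell_form (\<lambda>i. p * d i + q * d' i) (\<lambda>i. p * e i + q * e' i) V W
       = p * cell_form d e V W + q * cell_form d' e' V W"
  using summable_cell_form[OF assms(1,2,5,6)] summable_cell_form[OF assms(3,4,5,6)]
  unfolding cell_form_def
  by (simp add: suminf_mult[symmetric] suminf_add summable_mult) (simp add: algebra_simps)

text \<open>
  Diagonalization of a cell matrix: its eigenvalues \<open>d + e\<close> and \<open>d - e\<close> belong to the constant and
  the oscillating mode.
\<close>

lemma cell_energy_density:
  fixes d e u v :: real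
  shows "d * (u * u + v * v) + e * (u * v + v * u)
       = (d + e) / 2 * (u + v)\<^sup>2 + (d - e) / 2 * (u - v)\<^sup>2"
  by (simp add: power2_eq_square field_simps)

lemma cell_form_nonneg:
  assumes "Bseq d" "Bseq e" "square_summable W" "\<And>j. \<bar>e (Suc j)\<bar> \<le> d (Suc j)"
  shows "0 \<le> cell_form d e W W"
  unfolding cell_form_def cell_energy_density
proof (rule suminf_nonneg)
  show "summable (\<lambda>j. (d (Suc j) + e (Suc j)) / 2 * (W (Suc j) + W j)\<^sup>2
      + (d (Suc j) - e (Suc j)) / 2 * (W (Suc j) - W j)\<^sup>2)"
    using summable_cell_form[OF assms(1-3,3)] unfolding cell_energy_density .
  show "0 \<le> (d (Suc j) + e (Suc j)) / 2 * (W (Suc j) + W j)\<^sup>2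
      + (d (Suc j) - e (Suc j)) / 2 * (W (Suc j) - W j)\<^sup>2" for j
    using assms(4)[of j] by (intro add_nonneg_nonneg mult_nonneg_nonneg) auto
qed

text \<open>
  Lowering \<open>d\<close> by \<open>\<alpha>\<close> keeps every cell energy nonnegative, so a cell has energy at least
  \<open>\<alpha> (u\<^sup>2 + v\<^sup>2)\<close>; the square at its right node alone already exhausts the norm.
\<close>

lemma cell_form_coercive:
  assumes "Bseq d" "Bseq e" "W \<in> H_space" "0 \<le> \<alpha>" "\<And>j. \<bar>e (Suc j)\<bar> + \<alpha> \<le> d (Suc j)"
  shows "\<alpha> * (\<Sum>j. (W j)\<^sup>2) \<le> cell_form d e W W"
proof -
  have W: "W 0 = 0" "square_summable W"
    using assms by (auto simp: H_space_iff)
  have "\<alpha> * (\<Sum>j. (W j)\<^sup>2) = (\<Sum>j. \<alpha> * (W (Suc j))\<^sup>2)"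
    using suminf_split_head[of "\<lambda>j. (W j)\<^sup>2"] suminf_mult[of "\<lambda>j. (W (Suc j))\<^sup>2" \<alpha>]
      summable_Suc_iff[of "\<lambda>j. (W j)\<^sup>2"] W
    by (simp add: square_summable_def)
  also have "\<dots> \<le> cell_form d e W W"
    unfolding cell_form_def
  proof (rule suminf_le)
    show "summable (\<lambda>j. \<alpha> * (W (Suc j))\<^sup>2)"
      using W square_summable_Suc[of W]
      by (intro summable_mult) (simp only: square_summable_def)
    show "\<alpha> * (W (Suc j))\<^sup>2 \<le> d (Suc j) * (W (Suc j) * W (Suc j) + W j * W j)
        + e (Suc j) * (W (Suc j) * W j + W j * W (Suc j))" for j
    proof -
      let ?d = "d (Suc j) - \<alpha>" and ?e = "e (Suc j)"
      have "0 \<le> (?d + ?e) / 2 * (W (Suc j) + W j)\<^sup>2 + (?d - ?e) / 2 * (W (Suc j) - W j)\<^sup>2"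
        using assms(5)[of j] by (intro add_nonneg_nonneg mult_nonneg_nonneg) auto
      then show ?thesis
        unfolding cell_energy_density[symmetric]
        using mult_nonneg_nonneg[OF assms(4) zero_le_power2[of "W j"]]
        by (simp add: algebra_simps power2_eq_square)
    qed
  qed (rule summable_cell_form[OF assms(1,2) W(2) W(2)])
  finally show ?thesis .
qed

text \<open>
  Definiteness without coercivity: in a cell whose energy and left nodal value both vanish, what is
  left of the energy is \<open>d\<close> times the square of the right nodal value.
\<close>

lemma cell_form_eq_0_imp_zero:
  assumes "Bseq d" "Bseq e" "W \<in> H_space" "\<And>j. \<bar>e (Suc j)\<bar> \<le> d (Suc j)" "\<And>j. 0 < d (Suc j)"
    and "cell_form d e W W = 0"
  shows "W j = 0"
proof -
  have W: "W 0 = 0" "square_summable W"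
    using assms by (auto simp: H_space_iff)
  let ?g = "\<lambda>j. d (Suc j) * (W (Suc j) * W (Suc j) + W j * W j)
        + e (Suc j) * (W (Suc j) * W j + W j * W (Suc j))"
  have nonneg: "0 \<le> ?g j" for j
    unfolding cell_energy_density
    using assms(4)[of j] by (intro add_nonneg_nonneg mult_nonneg_nonneg) auto
  have zero: "?g j = 0" for j
    using suminf_eq_zero_iff[of ?g, OF summable_cell_form[OF assms(1,2) W(2) W(2)] nonneg]
      assms(6) unfolding cell_form_def by blast
  show ?thesis
  proof (induction j)
    case (Suc j)
    then show ?case
      using zero[of j] assms(5)[of j] by simp
  qed (rule W(1))
qed

section \<open>Solvability of coercive cell systems\<close>

text \<open>
  Boundedness on \<open>\<ell>\<^sup>2\<close>.  The row at a node consists of four products, so its square is at most four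
  times the sum of their squares, and every nodal value occurs in at most four products altogether.
\<close>

lemma suminf_square_cell_op_le:
  assumes "\<And>j. \<bar>d j\<bar> \<le> B" "\<And>j. \<bar>e j\<bar> \<le> B" "W \<in> H_space"
  shows "(\<Sum>j. (cell_op d e W (Suc j))\<^sup>2) \<le> 16 * B\<^sup>2 * (\<Sum>j. (W j)\<^sup>2)"
proof -
  have W: "W 0 = 0" "square_summable W"
    using assms by (auto simp: H_space_iff)
  have Bs: "Bseq d" "Bseq e"
    using assms(1,2) by (auto intro!: BseqI'[where K = B])
  have s0: "summable (\<lambda>j. (W j)\<^sup>2)" and s1: "summable (\<lambda>j. (W (Suc j))\<^sup>2)"
    and s2: "summable (\<lambda>j. (W (Suc (Suc j)))\<^sup>2)"
    using W(2) square_summable_Suc[of W] square_summable_Suc[of "\<lambda>j. W (Suc j)"]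
    by (simp_all only: square_summable_def)
  have pt: "(cell_op d e W (Suc j))\<^sup>2
      \<le> 4 * B\<^sup>2 * (2 * (W (Suc j))\<^sup>2 + (W j)\<^sup>2 + (W (Suc (Suc j)))\<^sup>2)" for j
  proof -
    have sq: "(k * y)\<^sup>2 \<le> B\<^sup>2 * y\<^sup>2" if "\<bar>k\<bar> \<le> B" for k y :: real
      using power_mono[OF that, of 2] by (simp add: power_mult_distrib mult_right_mono)
    have four: "(p + q + r + s)\<^sup>2 \<le> 4 * (p\<^sup>2 + q\<^sup>2 + r\<^sup>2 + s\<^sup>2)" for p q r s :: real
      using sum_squares_ge_zero[of "p - q" "p - r"] sum_squares_ge_zero[of "p - s" "q - r"]
        sum_squares_ge_zero[of "q - s" "r - s"]
      by (simp add: power2_eq_square algebra_simps)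
    have "(cell_op d e W (Suc j))\<^sup>2 = (d (Suc j) * W (Suc j) + d (Suc (Suc j)) * W (Suc j)
        + e (Suc j) * W j + e (Suc (Suc j)) * W (Suc (Suc j)))\<^sup>2"
      by (simp add: cell_op_def distrib_right)
    also have "\<dots> \<le> 4 * ((d (Suc j) * W (Suc j))\<^sup>2 + (d (Suc (Suc j)) * W (Suc j))\<^sup>2
        + (e (Suc j) * W j)\<^sup>2 + (e (Suc (Suc j)) * W (Suc (Suc j)))\<^sup>2)"
      by (rule four)
    also have "\<dots> \<le> 4 * (B\<^sup>2 * (W (Suc j))\<^sup>2 + B\<^sup>2 * (W (Suc j))\<^sup>2
        + B\<^sup>2 * (W j)\<^sup>2 + B\<^sup>2 * (W (Suc (Suc j)))\<^sup>2)"
      by (intro mult_left_mono add_mono sq assms) auto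
    finally show ?thesis
      by (simp add: algebra_simps)
  qed
  have "(\<Sum>j. (cell_op d e W (Suc j))\<^sup>2)
     \<le> (\<Sum>j. 4 * B\<^sup>2 * (2 * (W (Suc j))\<^sup>2 + (W j)\<^sup>2 + (W (Suc (Suc j)))\<^sup>2))"
    using square_summable_cell_op[OF Bs W(2)] square_summable_Suc[of "cell_op d e W"]
    by (intro suminf_le pt summable_mult summable_add s0 s1 s2) (simp only: square_summable_def)
  also have "\<dots> = 4 * B\<^sup>2 * (2 * (\<Sum>j. (W (Suc j))\<^sup>2) + (\<Sum>j. (W j)\<^sup>2) + (\<Sum>j. (W (Suc (Suc j)))\<^sup>2))"
    using s0 s1 s2 by (simp add: suminf_mult suminf_add[symmetric] summable_add summable_mult)
  also have "(\<Sum>j. (W (Suc j))\<^sup>2) = (\<Sum>j. (W j)\<^sup>2)"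
    using suminf_split_head[OF s0] W(1) by simp
  also have "(\<Sum>j. (W (Suc (Suc j)))\<^sup>2) = (\<Sum>j. (W j)\<^sup>2) - (W (Suc 0))\<^sup>2"
    using suminf_split_head[OF s0] suminf_split_head[OF s1] W(1) by simp
  also have "4 * B\<^sup>2 * (2 * (\<Sum>j. (W j)\<^sup>2) + (\<Sum>j. (W j)\<^sup>2) + ((\<Sum>j. (W j)\<^sup>2) - (W (Suc 0))\<^sup>2))
     \<le> 4 * B\<^sup>2 * (4 * (\<Sum>j. (W j)\<^sup>2))"
    by (intro mult_left_mono) auto
  finally show ?thesis
    by simp
qed

text \<open>
  Expanding the square of \<open>W - \<omega> T W\<close>, coercivity bounds the cross term by \<open>- 2 \<omega> \<alpha> \<parallel>W\<parallel>\<^sup>2\<close>, and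
  boundedness bounds the last term by \<open>\<omega>\<^sup>2 K \<parallel>W\<parallel>\<^sup>2\<close>; the choice \<open>\<omega> = \<alpha> / K\<close> minimizes the sum.
\<close>

lemma relaxation_contracts:
  assumes "\<And>j. \<bar>d j\<bar> \<le> B" "\<And>j. \<bar>e j\<bar> \<le> B" "W \<in> H_space"
    and "\<alpha> * (\<Sum>j. (W j)\<^sup>2) \<le> cell_form d e W W" "16 * B\<^sup>2 \<le> K" "0 < \<alpha>" "0 < K"
  defines "R \<equiv> \<lambda>j. if j = 0 then 0 else W j - \<alpha> / K * cell_op d e W j"
  shows "R \<in> H_space \<and> (\<Sum>j. (R j)\<^sup>2) \<le> (1 - \<alpha>\<^sup>2 / K) * (\<Sum>j. (W j)\<^sup>2)"
proof -
  have W: "W 0 = 0" "square_summable W"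
    using assms by (auto simp: H_space_iff)
  have Bs: "Bseq d" "Bseq e"
    using assms(1,2) by (auto intro!: BseqI'[where K = B])
  let ?S = "\<lambda>j. cell_op d e W (Suc j)" and ?N = "\<Sum>j. (W j)\<^sup>2"
  have sqS: "square_summable ?S"
    using square_summable_cell_op[OF Bs W(2)] by simp
  have sqW: "square_summable (\<lambda>j. W (Suc j))"
    using W by simp
  have "square_summable (\<lambda>j. R (Suc j))"
    unfolding R_def using square_summable_diff[OF sqW square_summable_cmult[OF sqS, of "\<alpha> / K"]]
    by simp
  then have R: "square_summable R"
    by simp
  have s0: "summable (\<lambda>j. (W j)\<^sup>2)" and s1: "summable (\<lambda>j. (W (Suc j))\<^sup>2)"
    and s2: "summable (\<lambda>j. (?S j)\<^sup>2)"
    using W(2) sqW sqS by (simp_all only: square_summable_def)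
  have s3: "summable (\<lambda>j. W (Suc j) * ?S j)"
    by (rule summable_mult_square_summable[OF sqW sqS])
  have N: "(\<Sum>j. (W (Suc j))\<^sup>2) = ?N"
    using suminf_split_head[OF s0] W(1) by simp
  have "(\<Sum>j. (R j)\<^sup>2) = (\<Sum>j. (R (Suc j))\<^sup>2)"
    using suminf_split_head[of "\<lambda>j. (R j)\<^sup>2"] R by (simp add: square_summable_def R_def)
  also have "\<dots> = (\<Sum>j. (W (Suc j))\<^sup>2 + ((\<alpha> / K)\<^sup>2 * (?S j)\<^sup>2 + (- 2 * (\<alpha> / K)) * (W (Suc j) * ?S j)))"
    by (simp add: R_def power2_diff power_mult_distrib power_divide algebra_simps)
  also have "\<dots> = ?N + ((\<alpha> / K)\<^sup>2 * (\<Sum>j. (?S j)\<^sup>2) + (- 2 * (\<alpha> / K)) * (\<Sum>j. W (Suc j) * ?S j))"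
    unfolding N[symmetric] using s1 s2 s3
    by (simp only: suminf_mult[symmetric] suminf_add summable_mult summable_add)
  also have "(\<Sum>j. W (Suc j) * ?S j) = cell_form d e W W"
    by (rule suminf_cell_op[OF Bs assms(3) W(2)])
  also have "?N + ((\<alpha> / K)\<^sup>2 * (\<Sum>j. (?S j)\<^sup>2) + (- 2 * (\<alpha> / K)) * cell_form d e W W)
      \<le> ?N + ((\<alpha> / K)\<^sup>2 * (K * ?N) + (- 2 * (\<alpha> / K)) * (\<alpha> * ?N))"
  proof (intro add_left_mono add_mono)
    have "(\<Sum>j. (?S j)\<^sup>2) \<le> 16 * B\<^sup>2 * ?N"
      by (rule suminf_square_cell_op_le[OF assms(1-3)])
    also have "\<dots> \<le> K * ?N"
      by (intro mult_right_mono assms suminf_nonneg s0) auto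
    finally show "(\<alpha> / K)\<^sup>2 * (\<Sum>j. (?S j)\<^sup>2) \<le> (\<alpha> / K)\<^sup>2 * (K * ?N)"
      by (rule mult_left_mono) simp
    show "- 2 * (\<alpha> / K) * cell_form d e W W \<le> - 2 * (\<alpha> / K) * (\<alpha> * ?N)"
      using assms(6,7) by (intro mult_left_mono_neg assms(4)) simp
  qed
  also have "\<dots> = (1 - \<alpha>\<^sup>2 / K) * ?N"
    using \<open>0 < K\<close> by (simp add: field_simps power2_eq_square)
  finally show ?thesis
    using R by (simp add: H_space_iff R_def)
qed

lemma L2_set_sum_le: "L2_set (\<lambda>j. \<Sum>i\<in>I. f i j) A \<le> (\<Sum>i\<in>I. L2_set (f i) A)"
proof (induction I rule: infinite_finite_induct)
  case (insert i I)
  then show ?case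
    using L2_set_triangle_ineq[of "f i" "\<lambda>j. \<Sum>i\<in>I. f i j" A] by simp
qed (simp_all add: L2_set_def)

text \<open>
  The completeness of \<open>\<ell>\<^sup>2\<close> behind the Neumann series.  The series converges at each node,
  and the triangle inequality on finitely many nodes bounds the norm of the sum uniformly in their
  number.
\<close>

lemma geometric_series_in_H_space:
  fixes D :: "nat \<Rightarrow> nat \<Rightarrow> real"
  assumes "\<And>n. D n \<in> H_space" "\<And>n. sqrt (\<Sum>j. (D n j)\<^sup>2) \<le> C * q ^ n" "0 \<le> C" "0 \<le> q" "q < 1"
  shows "summable (\<lambda>n. D n j)" "(\<lambda>j. \<Sum>n. D n j) \<in> H_space"
proof -
  have s: "summable (\<lambda>j. (D n j)\<^sup>2)" for n
    using assms(1) by (simp add: H_space_iff square_summable_def)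
  have sg: "summable (\<lambda>n. C * q ^ n)"
    using assms by (intro summable_mult summable_geometric) simp
  have L: "L2_set (D n) A \<le> C * q ^ n" if "finite A" for n A
    using sum_le_suminf[OF s that] assms(2)[of n]
    unfolding L2_set_def by (meson order_trans real_sqrt_le_iff zero_le_power2)
  have "\<bar>D n j\<bar> \<le> C * q ^ n" for n j
    using L[of "{j}"] by (simp add: L2_set_def)
  then show sD: "summable (\<lambda>n. D n j)" for j
    by (intro summable_comparison_test'[OF sg]) simp
  have "(\<Sum>j<N. (\<Sum>n. D n j)\<^sup>2) \<le> (\<Sum>n. C * q ^ n)\<^sup>2" for N
  proof -
    have "(\<Sum>j<N. (\<Sum>n<m. D n j)\<^sup>2) \<le> (\<Sum>n. C * q ^ n)\<^sup>2" for m
    proof -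
      have "L2_set (\<lambda>j. \<Sum>n<m. D n j) {..<N} \<le> (\<Sum>n<m. L2_set (D n) {..<N})"
        by (rule L2_set_sum_le)
      also have "\<dots> \<le> (\<Sum>n<m. C * q ^ n)"
        by (intro sum_mono L) simp
      also have "\<dots> \<le> (\<Sum>n. C * q ^ n)"
        by (intro sum_le_suminf sg) (use assms in auto)
      finally show ?thesis
        unfolding L2_set_def using real_sqrt_le_iff by (simp add: sqrt_le_D)
    qed
    moreover have "(\<lambda>m. \<Sum>j<N. (\<Sum>n<m. D n j)\<^sup>2) \<longlonglongrightarrow> (\<Sum>j<N. (\<Sum>n. D n j)\<^sup>2)"
      by (intro tendsto_sum tendsto_power summable_LIMSEQ sD)
    ultimately show ?thesis
      by (intro LIMSEQ_le_const2) auto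
  qed
  then have "summable (\<lambda>j. (\<Sum>n. D n j)\<^sup>2)"
    by (intro summableI_nonneg_bounded) auto
  then show "(\<lambda>j. \<Sum>n. D n j) \<in> H_space"
    using assms(1) by (simp add: H_space_iff square_summable_def)
qed

text \<open>
  With \<open>R = 1 - \<omega> T\<close> a contraction, the solution of \<open>T W = G\<close> is the Neumann series
  \<open>\<Sum>n. R\<^sup>n (\<omega> G)\<close>.  Convergence at each node is enough to verify the equation, since a row involves
  only three nodes; there the series of \<open>T D\<^sub>n = (D\<^sub>n - D\<^sub>n\<^sub>+\<^sub>1) / \<omega>\<close> telescopes.
\<close>

lemma coercive_cell_system_solvable:
  assumes "Bseq d" "Bseq e" "0 < \<alpha>" "\<And>W. W \<in> H_space \<Longrightarrow> \<alpha> * (\<Sum>j. (W j)\<^sup>2) \<le> cell_form d e W W"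
    and "square_summable G"
  obtains W where "W \<in> H_space" "\<And>j. j \<ge> 1 \<Longrightarrow> cell_op d e W j = G j"
proof -
  obtain B1 B2 where "\<And>j. \<bar>d j\<bar> \<le> B1" "\<And>j. \<bar>e j\<bar> \<le> B2"
    using assms(1,2) unfolding Bseq_def by auto
  then have B: "\<bar>d j\<bar> \<le> max B1 B2" "\<bar>e j\<bar> \<le> max B1 B2" for j
    by (auto simp: le_max_iff_disj)
  \<comment> \<open>The summand \<open>\<alpha>\<^sup>2\<close> makes \<open>1 - \<alpha>\<^sup>2 / K\<close> nonnegative, so that its square root is a contraction factor.\<close>
  define K where "K = 16 * (max B1 B2)\<^sup>2 + \<alpha>\<^sup>2"
  have K: "16 * (max B1 B2)\<^sup>2 \<le> K" "0 < K" "\<alpha>\<^sup>2 \<le> K"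
    using assms(3) by (auto simp: K_def add_nonneg_pos)
  define q where "q = sqrt (1 - \<alpha>\<^sup>2 / K)"
  have q: "0 \<le> q" "q < 1" "q\<^sup>2 = 1 - \<alpha>\<^sup>2 / K"
    using K assms(3) by (auto simp: q_def)
  define R where "R = (\<lambda>W j. if j = 0 then 0 else W j - \<alpha> / K * cell_op d e W j)"
  have R: "R W \<in> H_space" "(\<Sum>j. (R W j)\<^sup>2) \<le> q\<^sup>2 * (\<Sum>j. (W j)\<^sup>2)" if "W \<in> H_space" for W
    using relaxation_contracts[OF B that assms(4)[OF that] K(1) assms(3) K(2)]
    by (simp_all add: R_def q)
  define D where "D n = (R ^^ n) (\<lambda>j. if j = 0 then 0 else \<alpha> / K * G j)" for n
  have D0: "D 0 \<in> H_space"
    using square_summable_cmult[of "\<lambda>j. G (Suc j)" "\<alpha> / K"] assms(5)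
      square_summable_Suc[of "\<lambda>j. if j = 0 then 0 else \<alpha> / K * G j"]
    by (simp add: D_def H_space_iff)
  have DSuc: "D (Suc n) = R (D n)" for n
    by (simp add: D_def)
  have D: "D n \<in> H_space" for n
    by (induction n) (simp_all add: D0 DSuc R)
  let ?C = "sqrt (\<Sum>j. (D 0 j)\<^sup>2)"
  have "sqrt (\<Sum>j. (D n j)\<^sup>2) \<le> ?C * q ^ n" for n
  proof (induction n)
    case (Suc n)
    have "sqrt (\<Sum>j. (D (Suc n) j)\<^sup>2) \<le> sqrt (q\<^sup>2 * (\<Sum>j. (D n j)\<^sup>2))"
      using R(2)[OF D] by (simp add: DSuc)
    also have "\<dots> = q * sqrt (\<Sum>j. (D n j)\<^sup>2)"
      using q(1) by (simp add: real_sqrt_mult)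
    also have "\<dots> \<le> q * (?C * q ^ n)"
      by (rule mult_left_mono[OF Suc q(1)])
    finally show ?case
      by (simp add: mult_ac)
  qed simp
  moreover have "0 \<le> ?C"
    using D0 by (intro real_sqrt_ge_zero suminf_nonneg) (auto simp: H_space_iff square_summable_def)
  ultimately have sD: "summable (\<lambda>n. D n j)" and W: "(\<lambda>j. \<Sum>n. D n j) \<in> H_space" for j
    using geometric_series_in_H_space[of D ?C q] D q by auto
  have "cell_op d e (\<lambda>j. \<Sum>n. D n j) j = G j" if "j \<ge> 1" for j
  proof -
    have "cell_op d e (\<lambda>j. \<Sum>n. D n j) j = (\<Sum>n. cell_op d e (D n) j)"
      unfolding cell_op_def
      using sD by (simp only: suminf_mult[symmetric] suminf_add summable_mult summable_add)
    also have "\<dots> = (\<Sum>n. K / \<alpha> * (D n j - D (Suc n) j))"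
      using that K assms(3) by (simp add: DSuc R_def)
    also have "\<dots> = K / \<alpha> * (D 0 j)"
      using sD[of j] summable_Suc_iff[of "\<lambda>n. D n j"] suminf_split_head[OF sD[of j]]
      by (simp only: suminf_mult summable_diff flip: suminf_diff) simp
    also have "\<dots> = G j"
      using that K assms(3) by (simp add: D_def)
    finally show ?thesis .
  qed
  with W show thesis
    by (rule that)
qed

section \<open>The spatial operators of the scheme as cell operators\<close>

text \<open>
  The factor \<open>h\<^bsub>j+1/2\<^esub>\<close> in the denominators of the difference operators cancels the weight of the
  inner product, so the cell matrices contain only the length of their own cell.
\<close>

definition mass_diag :: "(nat \<Rightarrow> real) \<Rightarrow> real \<Rightarrow> (nat \<Rightarrow> real) \<Rightarrow> nat \<Rightarrow> real" where
  "mass_diag x \<theta> k i = (1 / 2 - \<theta>) * (step x i * k i)"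

definition mass_off :: "(nat \<Rightarrow> real) \<Rightarrow> real \<Rightarrow> (nat \<Rightarrow> real) \<Rightarrow> nat \<Rightarrow> real" where
  "mass_off x \<theta> k i = \<theta> * (step x i * k i)"

definition stiff_diag :: "(nat \<Rightarrow> real) \<Rightarrow> (nat \<Rightarrow> real) \<Rightarrow> nat \<Rightarrow> real" where
  "stiff_diag x b i = b i / step x i"

definition elliptic_diag :: "(nat \<Rightarrow> real) \<Rightarrow> real \<Rightarrow> (nat \<Rightarrow> real) \<Rightarrow> (nat \<Rightarrow> real) \<Rightarrow> nat \<Rightarrow> real" where
  "elliptic_diag x \<theta> b c i = stiff_diag x b i + mass_diag x \<theta> c i"

definition elliptic_off :: "(nat \<Rightarrow> real) \<Rightarrow> real \<Rightarrow> (nat \<Rightarrow> real) \<Rightarrow> (nat \<Rightarrow> real) \<Rightarrow> nat \<Rightarrow> real" where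
  "elliptic_off x \<theta> b c i = - stiff_diag x b i + mass_off x \<theta> c i"

locale regular_mesh =
  fixes x :: "nat \<Rightarrow> real" and h_low :: real
  assumes h_low_pos: "0 < h_low"
    and h_low_le: "\<And>j. h_low \<le> step x (Suc j)"
    and Bseq_step: "Bseq (step x)"
begin

lemma step_pos: "0 < step x (Suc j)"
  using h_low_pos h_low_le[of j] by linarith

lemma step_half_pos: "0 < step_half x (Suc j)"
  using step_pos[of j] step_pos[of "Suc j"] by (simp add: step_half_def)

lemma Bseq_step_half: "Bseq (step_half x)"
proof -
  have "Bseq (\<lambda>j. step x (j + 1))"
    using Bseq_step by (simp add: Bseq_Suc_iff)
  from Bseq_cmult[OF Bseq_plus[OF Bseq_step this], of "1 / 2"] show ?thesis
    by (simp add: step_half_def[abs_def])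
qed

lemma Bseq_mass:
  assumes "Bseq k"
  shows "Bseq (mass_diag x \<theta> k)" "Bseq (mass_off x \<theta> k)"
  unfolding mass_diag_def[abs_def] mass_off_def[abs_def]
  by (intro Bseq_cmult Bseq_mult Bseq_step assms)+

lemma Bseq_stiff:
  assumes "Bseq b"
  shows "Bseq (stiff_diag x b)" "Bseq (\<lambda>i. - stiff_diag x b i)"
proof -
  obtain K where K: "0 < K" "\<And>j. \<bar>b j\<bar> \<le> K"
    using assms unfolding Bseq_def by auto
  have "norm (stiff_diag x b (Suc j)) \<le> K / h_low" for j
    using K(2)[of "Suc j"] K(1) h_low_le[of j] step_pos[of j] h_low_pos
    by (simp add: stiff_diag_def frac_le)
  then have "Bseq (\<lambda>j. stiff_diag x b (Suc j))"
    by (rule BseqI')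
  then show "Bseq (stiff_diag x b)"
    by (simp only: Bseq_Suc_iff)
  then show "Bseq (\<lambda>i. - stiff_diag x b i)"
    by (simp add: Bseq_minus_iff)
qed

lemma Bseq_elliptic:
  assumes "Bseq b" "Bseq c"
  shows "Bseq (elliptic_diag x \<theta> b c)" "Bseq (elliptic_off x \<theta> b c)"
  unfolding elliptic_diag_def[abs_def] elliptic_off_def[abs_def]
  by (intro Bseq_plus Bseq_mass Bseq_stiff assms)+

lemma step_half_C_op:
  "step_half x (Suc j) * C_op x \<theta> k W (Suc j) = cell_op (mass_diag x \<theta> k) (mass_off x \<theta> k) W (Suc j)"
  using step_half_pos[of j]
  by (simp add: C_op_def sx_hat_def cell_op_def mass_diag_def mass_off_def field_simps)

lemma step_half_A_op:
  "step_half x (Suc j) * A_op x \<theta> b c W (Suc j)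
   = cell_op (elliptic_diag x \<theta> b c) (elliptic_off x \<theta> b c) W (Suc j)"
proof -
  have "step_half x (Suc j) * (- dx_hat x (\<lambda>i. b i * dx_bar x W i) (Suc j))
      = cell_op (stiff_diag x b) (\<lambda>i. - stiff_diag x b i) W (Suc j)"
    using step_half_pos[of j]
    by (simp add: dx_hat_def dx_bar_def cell_op_def stiff_diag_def)
       (simp add: diff_divide_distrib add_divide_distrib algebra_simps)
  then show ?thesis
    using cell_op_coeff_lincomb[of 1 "stiff_diag x b" 1 "mass_diag x \<theta> c"
        "\<lambda>i. - stiff_diag x b i" "mass_off x \<theta> c" W "Suc j"]
    by (simp add: A_op_def right_diff_distrib step_half_C_op elliptic_diag_def[abs_def]
        elliptic_off_def[abs_def])
qed

lemma inner_H_C_op: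
  assumes "Bseq k" "V \<in> H_space" "square_summable W"
  shows "inner_H x (C_op x \<theta> k W) V = cell_form (mass_diag x \<theta> k) (mass_off x \<theta> k) V W"
  using suminf_cell_op[OF Bseq_mass[OF assms(1)] assms(2,3), of \<theta> \<theta>]
  by (simp add: inner_H_def mult_ac flip: step_half_C_op)

lemma inner_Ht_dx_bar:
  "inner_Ht x (\<lambda>j. b j * dx_bar x V j) (dx_bar x W)
   = cell_form (stiff_diag x b) (\<lambda>i. - stiff_diag x b i) V W"
proof -
  have "b (Suc j) * dx_bar x V (Suc j) * dx_bar x W (Suc j) * step x (Suc j)
     = stiff_diag x b (Suc j) * (V (Suc j) * W (Suc j) + V j * W j)
       + - stiff_diag x b (Suc j) * (V (Suc j) * W j + V j * W (Suc j))" for j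
    using step_pos[of j] by (simp add: dx_bar_def stiff_diag_def field_simps)
  then show ?thesis
    unfolding inner_Ht_def cell_form_def by simp
qed

lemma L_form_eq_cell_form:
  assumes "Bseq b" "Bseq c" "V \<in> H_space" "W \<in> H_space"
  shows "L_form x \<theta> b c V W = cell_form (elliptic_diag x \<theta> b c) (elliptic_off x \<theta> b c) V W"
proof -
  have "square_summable V" "square_summable W"
    using assms by (auto simp: H_space_iff)
  then show ?thesis
    using cell_form_coeff_lincomb[OF Bseq_stiff[OF assms(1)] Bseq_mass[OF assms(2)], of V W 1 1 \<theta> \<theta>]
    by (simp add: L_form_def inner_Ht_dx_bar inner_H_C_op assms elliptic_diag_def[abs_def]
        elliptic_off_def[abs_def] cell_form_sym[of _ _ W V])
qed

text \<open>
  The divergence-form source is moved to the test function: this is where \<open>F1\<close> loses its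
  difference quotient.
\<close>

lemma inner_H_dx_hat:
  assumes "square_summable f" "V \<in> H_space"
  shows "inner_H x (dx_hat x f) V = - inner_Ht x f (dx_bar x V)"
proof -
  have V: "V 0 = 0" "square_summable V" "square_summable (\<lambda>j. V (Suc j))"
    and f: "square_summable (\<lambda>j. f (Suc j))" "square_summable (\<lambda>j. - f (Suc j))"
    using assms square_summable_cmult[of "\<lambda>j. f (Suc j)" "-1"] by (auto simp: H_space_iff)
  have dx: "dx_bar x V (Suc j) * step x (Suc j) = V (Suc j) - V j" for j
    using step_pos[of j] by (simp add: dx_bar_def)
  have "inner_H x (dx_hat x f) V = (\<Sum>j. V (Suc j) * (- f (Suc j) + f (Suc (Suc j))))"
    unfolding inner_H_def dx_hat_def using step_half_pos
    by (intro suminf_cong) (simp add: less_imp_neq[symmetric])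
  also have "\<dots> = (\<Sum>j. V (Suc j) * - f (Suc j) + V j * f (Suc j))"
    by (rule suminf_nodal_eq_suminf_cell[of V "\<lambda>j. - f j" f])
       (use V(1) summable_mult_square_summable[OF V(3) f(2)]
         summable_mult_square_summable[OF V(2) f(1)] in auto)
  also have "\<dots> = (\<Sum>j. - (f (Suc j) * dx_bar x V (Suc j) * step x (Suc j)))"
    by (intro suminf_cong) (simp only: mult.assoc dx, simp add: algebra_simps)
  also have "\<dots> = - inner_Ht x f (dx_bar x V)"
    unfolding inner_Ht_def
  proof (rule suminf_minus)
    have "summable (\<lambda>j. f (Suc j) * (V (Suc j) - V j))"
      by (intro summable_mult_square_summable square_summable_diff f V)
    then show "summable (\<lambda>j. f (Suc j) * dx_bar x V (Suc j) * step x (Suc j))"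
      by (simp only: mult.assoc dx)
  qed
  finally show ?thesis .
qed

lemma square_summable_dx_hat: "square_summable f \<Longrightarrow> square_summable (\<lambda>j. step_half x (Suc j) * dx_hat x f (Suc j))"
  using square_summable_diff[of "\<lambda>j. f (Suc (Suc j))" "\<lambda>j. f (Suc j)"]
    square_summable_Suc[of "\<lambda>j. f (Suc j)"] step_half_pos
  by (simp add: dx_hat_def less_imp_neq[symmetric])

lemma square_summable_dx_bar:
  assumes "square_summable V"
  shows "square_summable (dx_bar x V)"
proof -
  have "square_summable (\<lambda>j. stiff_diag x (\<lambda>_. 1) j * (V j - V (j - 1)))"
    by (intro square_summable_Bseq_mult Bseq_stiff square_summable_diff square_summable_pred assms) auto
  then show ?thesis
    by (simp add: stiff_diag_def dx_bar_def[abs_def])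
qed

lemma inner_H_le:
  assumes "square_summable V" "square_summable W"
  shows "\<bar>inner_H x V W\<bar> \<le> norm_H x V * norm_H x W"
  unfolding inner_H_def norm_H_def
  by (rule weighted_Cauchy_Schwarz_suminf)
     (use assms Bseq_step_half step_half_pos in \<open>auto simp: Bseq_Suc_iff less_imp_le\<close>)

lemma inner_Ht_le:
  assumes "square_summable V" "square_summable W"
  shows "\<bar>inner_Ht x V W\<bar> \<le> norm_Ht x V * norm_Ht x W"
  unfolding inner_Ht_def norm_Ht_def
  by (rule weighted_Cauchy_Schwarz_suminf)
     (use assms Bseq_step step_pos in \<open>auto simp: Bseq_Suc_iff less_imp_le\<close>)

lemma norm_H_nonneg: "square_summable W \<Longrightarrow> 0 \<le> norm_H x W"
  and norm_Ht_nonneg: "square_summable W \<Longrightarrow> 0 \<le> norm_Ht x W"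
proof -
  have *: "0 \<le> (\<Sum>j. W (Suc j) * W (Suc j) * w (Suc j))"
    if "square_summable W" "Bseq w" "\<And>j. 0 \<le> w (Suc j)" for w
  proof (rule suminf_nonneg)
    have "Bseq (\<lambda>j. w (Suc j))" "square_summable (\<lambda>j. W (Suc j))"
      using that by (simp_all add: Bseq_Suc_iff)
    from summable_mult_square_summable[OF square_summable_Bseq_mult[OF this] this(2)]
    show "summable (\<lambda>j. W (Suc j) * W (Suc j) * w (Suc j))"
      by (simp add: mult_ac)
  qed (use that in simp)
  show "square_summable W \<Longrightarrow> 0 \<le> norm_H x W"
    unfolding norm_H_def inner_H_def
    using *[OF _ Bseq_step_half] step_half_pos by (simp add: less_imp_le)
  show "square_summable W \<Longrightarrow> 0 \<le> norm_Ht x W"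
    unfolding norm_Ht_def inner_Ht_def
    using *[OF _ Bseq_step] step_pos by (simp add: less_imp_le)
qed

lemma inner_H_lincomb_right:
  assumes "square_summable f" "square_summable V" "square_summable W"
  shows "inner_H x f (\<lambda>i. p * V i + q * W i) = p * inner_H x f V + q * inner_H x f W"
proof -
  have s: "summable (\<lambda>j. f (Suc j) * Y (Suc j) * step_half x (Suc j))" if "square_summable Y" for Y
  proof -
    have "Bseq (\<lambda>j. step_half x (Suc j))" "square_summable (\<lambda>j. Y (Suc j))"
      "square_summable (\<lambda>j. f (Suc j))"
      using that Bseq_step_half assms by (simp_all add: Bseq_Suc_iff)
    from summable_mult_square_summable[OF square_summable_Bseq_mult[OF this(1,2)] this(3)]
    show ?thesis
      by (simp add: mult_ac)
  qed
  show ?thesis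
    unfolding inner_H_def using s[OF assms(2)] s[OF assms(3)]
    by (simp add: suminf_mult[symmetric] suminf_add summable_mult) (simp add: algebra_simps)
qed

text \<open>
  The trapezoidal lumping of the norm into cells makes it comparable with the other forms cell by
  cell.
\<close>

lemma norm_H_sq_eq_cell_form:
  assumes "W \<in> H_space"
  shows "inner_H x W W = cell_form (\<lambda>j. (1 / 2) * step x j) (\<lambda>_. 0) W W"
proof -
  have "(\<Sum>j. W (Suc j) * cell_op (\<lambda>j. (1 / 2) * step x j) (\<lambda>_. 0) W (Suc j))
      = cell_form (\<lambda>j. (1 / 2) * step x j) (\<lambda>_. 0) W W"
    using assms by (intro suminf_cell_op Bseq_cmult Bseq_step) (auto simp: H_space_iff)
  moreover have "W (Suc j) * cell_op (\<lambda>j. (1 / 2) * step x j) (\<lambda>_. 0) W (Suc j)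
      = W (Suc j) * W (Suc j) * step_half x (Suc j)" for j
    by (simp add: cell_op_def step_half_def field_simps)
  ultimately show ?thesis
    unfolding inner_H_def by (simp only:)
qed

end

text \<open>
  For \<open>\<theta> \<ge> 0\<close> the inequality is \<open>2 \<theta> \<le> 1/2\<close>; for \<open>\<theta> < 0\<close> it holds with the margin \<open>s / 2\<close>.
\<close>

lemma mass_dominance:
  fixes \<theta> s :: real
  assumes "\<theta> \<le> 1 / 4" "0 \<le> s"
  shows "\<bar>\<theta> * s\<bar> \<le> (1 / 2 - \<theta>) * s"
proof -
  have "\<bar>\<theta>\<bar> * s \<le> (1 / 2 - \<theta>) * s"
    using assms by (intro mult_right_mono) auto
  then show ?thesis
    using assms by (simp add: abs_mult)
qed

locale parabolic_mesh = regular_mesh +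
  fixes \<rho>h bh ch :: "nat \<Rightarrow> real" and \<rho>_low \<nu> \<theta> :: real
  assumes \<rho>_low_pos: "0 < \<rho>_low" and \<rho>_low_le: "\<And>j. \<rho>_low \<le> \<rho>h (Suc j)" and Bseq_\<rho>: "Bseq \<rho>h"
    and \<nu>_pos: "0 < \<nu>" and \<nu>_le: "\<And>j. \<nu> \<le> bh (Suc j)" and Bseq_b: "Bseq bh"
    and c_nonneg: "\<And>j. 0 \<le> ch (Suc j)" and Bseq_c: "Bseq ch"
    and \<theta>_le: "\<theta> \<le> 1 / 4"
begin

abbreviation "C_form \<equiv> cell_form (mass_diag x \<theta> \<rho>h) (mass_off x \<theta> \<rho>h)"
abbreviation "elliptic_form \<equiv> cell_form (elliptic_diag x \<theta> bh ch) (elliptic_off x \<theta> bh ch)"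

lemma \<rho>_pos: "0 < \<rho>h (Suc j)"
  using \<rho>_low_pos \<rho>_low_le[of j] by linarith

lemma b_pos: "0 < bh (Suc j)"
  using \<nu>_pos \<nu>_le[of j] by linarith

lemma mass_off_le:
  assumes "0 \<le> k (Suc j)"
  shows "\<bar>mass_off x \<theta> k (Suc j)\<bar> \<le> mass_diag x \<theta> k (Suc j)"
  unfolding mass_off_def mass_diag_def
  by (rule mass_dominance[OF \<theta>_le]) (use assms step_pos[of j] in simp)

lemma elliptic_off_le: "\<bar>elliptic_off x \<theta> bh ch (Suc j)\<bar> \<le> elliptic_diag x \<theta> bh ch (Suc j)"
proof -
  have "0 \<le> stiff_diag x bh (Suc j)"
    using b_pos[of j] step_pos[of j] by (simp add: stiff_diag_def)
  then show ?thesis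
    using mass_off_le[of ch j, OF c_nonneg] unfolding elliptic_off_def elliptic_diag_def by linarith
qed

lemma norm_C_sq:
  assumes "W \<in> H_space"
  shows "(norm_C x \<theta> \<rho>h W)\<^sup>2 = C_form W W"
proof -
  have W: "square_summable W"
    using assms by (simp add: H_space_iff)
  have "0 \<le> C_form W W"
    by (intro cell_form_nonneg Bseq_mass Bseq_\<rho> W mass_off_le less_imp_le[OF \<rho>_pos])
  then show ?thesis
    by (simp add: norm_C_def inner_H_C_op[OF Bseq_\<rho> assms W])
qed

lemma norm_C_nonneg:
  assumes "W \<in> H_space"
  shows "0 \<le> norm_C x \<theta> \<rho>h W"
proof -
  have W: "square_summable W"
    using assms by (simp add: H_space_iff)
  have "0 \<le> C_form W W"
    using norm_C_sq[OF assms] by (metis zero_le_power2)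
  then show ?thesis
    by (simp add: norm_C_def inner_H_C_op[OF Bseq_\<rho> assms W])
qed

lemma norm_L_sq:
  assumes "W \<in> H_space"
  shows "(norm_L x \<theta> bh ch W)\<^sup>2 = elliptic_form W W"
proof -
  have W: "square_summable W"
    using assms by (simp add: H_space_iff)
  have "0 \<le> elliptic_form W W"
    by (intro cell_form_nonneg Bseq_elliptic Bseq_b Bseq_c W elliptic_off_le)
  then show ?thesis
    by (simp add: norm_L_def L_form_eq_cell_form[OF Bseq_b Bseq_c assms assms])
qed

text \<open>
  The smaller eigenvalue of the averaging cell matrix is \<open>1/2 - \<theta> - \<bar>\<theta>\<bar> = c_const \<theta> / 2\<close> times
  \<open>h \<rho>\<close>, whereas the norm has the cell matrix \<open>h / 2\<close> times the identity.  The difference of the two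
  forms is again a cell form, and \<open>cell_form_nonneg\<close> applies to it.
\<close>

lemma norm_H_le_norm_C:
  assumes "\<theta> < 1 / 4" "W \<in> H_space"
  shows "norm_H x W \<le> 1 / sqrt (c_const \<theta> * \<rho>_low) * norm_C x \<theta> \<rho>h W"
proof -
  let ?c = "c_const \<theta>"
  have c: "0 < ?c"
    using assms(1) by (simp add: c_const_def)
  have W: "square_summable W"
    using assms by (simp add: H_space_iff)
  have "0 \<le> cell_form (\<lambda>i. 1 * mass_diag x \<theta> \<rho>h i + (- (?c * \<rho>_low)) * ((1 / 2) * step x i))
      (\<lambda>i. 1 * mass_off x \<theta> \<rho>h i + (- (?c * \<rho>_low)) * 0) W W"
  proof (intro cell_form_nonneg W)
    fix j
    let ?h = "step x (Suc j)"
    have "?c / 2 * (?h * \<rho>_low) \<le> ?c / 2 * (?h * \<rho>h (Suc j))"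
      using c step_pos[of j] \<rho>_low_le[of j] by (intro mult_left_mono) auto
    moreover have "(1 / 2 - \<theta>) * (?h * \<rho>h (Suc j)) - ?c / 2 * (?h * \<rho>h (Suc j)) = \<bar>\<theta>\<bar> * (?h * \<rho>h (Suc j))"
      unfolding left_diff_distrib[symmetric] by (simp add: c_const_def max_def field_simps)
    ultimately show "\<bar>1 * mass_off x \<theta> \<rho>h (Suc j) + (- (?c * \<rho>_low)) * 0\<bar>
        \<le> 1 * mass_diag x \<theta> \<rho>h (Suc j) + (- (?c * \<rho>_low)) * ((1 / 2) * ?h)"
      using step_pos[of j] \<rho>_pos[of j] by (simp add: mass_off_def mass_diag_def abs_mult mult_ac)
  qed (intro Bseq_plus Bseq_cmult Bseq_mass Bseq_\<rho> Bseq_step; simp)+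
  also have "\<dots> = 1 * C_form W W + (- (?c * \<rho>_low)) * cell_form (\<lambda>j. (1 / 2) * step x j) (\<lambda>_. 0) W W"
    by (intro cell_form_coeff_lincomb W Bseq_mass Bseq_\<rho> Bseq_cmult Bseq_step) simp
  finally have "?c * \<rho>_low * inner_H x W W \<le> (norm_C x \<theta> \<rho>h W)\<^sup>2"
    using norm_C_sq[OF assms(2)] norm_H_sq_eq_cell_form[OF assms(2)] by simp
  then have "sqrt (?c * \<rho>_low * inner_H x W W) \<le> norm_C x \<theta> \<rho>h W"
    using norm_C_nonneg[OF assms(2)] by (simp add: real_le_lsqrt)
  then have "sqrt (?c * \<rho>_low) * norm_H x W \<le> norm_C x \<theta> \<rho>h W"
    by (simp add: norm_H_def real_sqrt_mult)
  then show ?thesis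
    using c \<rho>_low_pos by (simp add: field_simps)
qed

text \<open>
  Subtracting \<open>\<nu>\<close> times the stiffness form with unit coefficient leaves the stiffness form of
  \<open>b - \<nu>\<close> and the averaging form of \<open>c\<close>, which are both nonnegative.
\<close>

lemma norm_Ht_dx_bar_le:
  assumes "W \<in> H_space"
  shows "\<nu> * (norm_Ht x (dx_bar x W))\<^sup>2 \<le> (norm_L x \<theta> bh ch W)\<^sup>2"
proof -
  have W: "square_summable W"
    using assms by (simp add: H_space_iff)
  let ?S = "stiff_diag x (\<lambda>_. 1)"
  have "0 \<le> cell_form (\<lambda>i. 1 * elliptic_diag x \<theta> bh ch i + (- \<nu>) * ?S i)
      (\<lambda>i. 1 * elliptic_off x \<theta> bh ch i + (- \<nu>) * - ?S i) W W"
  proof (intro cell_form_nonneg W)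
    fix j
    have "0 \<le> stiff_diag x bh (Suc j) - \<nu> * ?S (Suc j)"
      using \<nu>_le[of j] step_pos[of j] by (simp add: stiff_diag_def divide_right_mono)
    then show "\<bar>1 * elliptic_off x \<theta> bh ch (Suc j) + (- \<nu>) * - ?S (Suc j)\<bar>
        \<le> 1 * elliptic_diag x \<theta> bh ch (Suc j) + (- \<nu>) * ?S (Suc j)"
      using mass_off_le[of ch j, OF c_nonneg] unfolding elliptic_off_def elliptic_diag_def by simp
  qed (intro Bseq_plus Bseq_cmult Bseq_elliptic Bseq_b Bseq_c Bseq_stiff; simp)+
  also have "\<dots> = 1 * elliptic_form W W + (- \<nu>) * cell_form ?S (\<lambda>i. - ?S i) W W"
    by (intro cell_form_coeff_lincomb W Bseq_elliptic Bseq_b Bseq_c Bseq_stiff) simp_all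
  finally have "\<nu> * cell_form ?S (\<lambda>i. - ?S i) W W \<le> (norm_L x \<theta> bh ch W)\<^sup>2"
    by (simp add: norm_L_sq[OF assms])
  moreover have "(norm_Ht x (dx_bar x W))\<^sup>2 = cell_form ?S (\<lambda>i. - ?S i) W W"
    using norm_Ht_nonneg[OF square_summable_dx_bar[OF W]] inner_Ht_dx_bar[of "\<lambda>_. 1" W W]
    by (simp add: norm_Ht_def)
  ultimately show ?thesis
    by simp
qed

section \<open>One time step\<close>

text \<open>
  Cell matrices of \<open>p C + q A\<close>.  The unknown of a time step is governed by \<open>q = \<sigma>\<close>, the previous
  layer by \<open>q = \<sigma> - 1\<close>, both with \<open>p = 1 / \<tau>\<close>.
\<close>

definition step_diag :: "real \<Rightarrow> real \<Rightarrow> nat \<Rightarrow> real" where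
  "step_diag p q i = p * mass_diag x \<theta> \<rho>h i + q * elliptic_diag x \<theta> bh ch i"

definition step_off :: "real \<Rightarrow> real \<Rightarrow> nat \<Rightarrow> real" where
  "step_off p q i = p * mass_off x \<theta> \<rho>h i + q * elliptic_off x \<theta> bh ch i"

lemma Bseq_step_coeffs: "Bseq (step_diag p q)" "Bseq (step_off p q)"
  unfolding step_diag_def[abs_def] step_off_def[abs_def]
  by (intro Bseq_plus Bseq_cmult Bseq_mass Bseq_elliptic Bseq_\<rho> Bseq_b Bseq_c)+

lemma scheme_row_iff:
  "C_op x \<theta> \<rho>h (\<lambda>i. (U i - U' i) / \<tau>) (Suc j) + A_op x \<theta> bh ch (\<lambda>i. \<sigma> * U i + (1 - \<sigma>) * U' i) (Suc j) = f
   \<longleftrightarrow> cell_op (step_diag (1 / \<tau>) \<sigma>) (step_off (1 / \<tau>) \<sigma>) U (Suc j)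
     = step_half x (Suc j) * f
       + cell_op (step_diag (1 / \<tau>) (\<sigma> - 1)) (step_off (1 / \<tau>) (\<sigma> - 1)) U' (Suc j)"
  (is "?l = f \<longleftrightarrow> ?r")
proof -
  have d: "(\<lambda>i. (U i - U' i) / \<tau>) = (\<lambda>i. (1 / \<tau>) * U i + (- (1 / \<tau>)) * U' i)"
    by (simp add: fun_eq_iff diff_divide_distrib)
  have "?l = f \<longleftrightarrow> step_half x (Suc j) * ?l = step_half x (Suc j) * f"
    using step_half_pos[of j] by simp
  also have "\<dots> \<longleftrightarrow> ?r"
    unfolding distrib_left step_half_C_op step_half_A_op d cell_op_lincomb
      step_diag_def[abs_def] step_off_def[abs_def] cell_op_coeff_lincomb
    by (auto simp: algebra_simps)
  finally show ?thesis .
qed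

lemma step_coeffs_dominance:
  assumes "0 < \<tau>" "0 \<le> \<sigma>"
  shows "\<bar>step_off (1 / \<tau>) \<sigma> (Suc j)\<bar> \<le> step_diag (1 / \<tau>) \<sigma> (Suc j)"
    and "0 < step_diag (1 / \<tau>) \<sigma> (Suc j)"
proof -
  have *: "\<bar>p * v\<bar> \<le> p * u" if "\<bar>v\<bar> \<le> u" "0 \<le> p" for p u v :: real
    using that by (simp add: abs_mult mult_left_mono)
  show "\<bar>step_off (1 / \<tau>) \<sigma> (Suc j)\<bar> \<le> step_diag (1 / \<tau>) \<sigma> (Suc j)"
    unfolding step_off_def step_diag_def
    by (intro order_trans[OF abs_triangle_ineq] add_mono * mass_off_le elliptic_off_le
        less_imp_le[OF \<rho>_pos]) (use assms in auto)
  have "0 < mass_diag x \<theta> \<rho>h (Suc j)"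
    unfolding mass_diag_def using \<theta>_le step_pos[of j] \<rho>_pos[of j] by simp
  moreover have "0 \<le> elliptic_diag x \<theta> bh ch (Suc j)"
    using elliptic_off_le[of j] by linarith
  ultimately show "0 < step_diag (1 / \<tau>) \<sigma> (Suc j)"
    unfolding step_diag_def using assms by (intro add_pos_nonneg) simp_all
qed

text \<open>
  The two entries of the minimum are lower bounds for the eigenvalues \<open>d + e\<close> and \<open>d - e\<close>.  The
  stiffness part contributes \<open>0\<close> to the first and \<open>2 b / h\<close> to the second; the second is the one that
  degenerates when \<open>\<sigma> = 0\<close> and \<open>\<theta> = 1/4\<close>.
\<close>

lemma step_coeffs_coercive:
  assumes "0 < \<tau>" "0 \<le> \<sigma>" "\<not> (\<sigma> = 0 \<and> \<theta> = 1 / 4)"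
  obtains \<alpha> where "0 < \<alpha>" "\<And>j. \<bar>step_off (1 / \<tau>) \<sigma> (Suc j)\<bar> + \<alpha> \<le> step_diag (1 / \<tau>) \<sigma> (Suc j)"
proof -
  obtain H where H: "0 < H" "\<And>j. \<bar>step x j\<bar> \<le> H"
    using Bseq_step unfolding Bseq_def by auto
  let ?s = "h_low * \<rho>_low"
  define \<alpha> where "\<alpha> = min (1 / \<tau> * (1 / 2 * ?s)) (1 / \<tau> * ((1 / 2 - 2 * \<theta>) * ?s) + \<sigma> * (2 * \<nu> / H))"
  have s: "0 < ?s"
    using h_low_pos \<rho>_low_pos by simp
  have "0 < 1 / \<tau> * ((1 / 2 - 2 * \<theta>) * ?s) + \<sigma> * (2 * \<nu> / H)"
  proof (cases "\<sigma> = 0")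
    case True
    with assms(3) \<theta>_le have "0 < 1 / 2 - 2 * \<theta>"
      by simp
    with True s assms(1) show ?thesis
      by simp
  next
    case False
    with assms(2) \<nu>_pos H(1) have "0 < \<sigma> * (2 * \<nu> / H)"
      by simp
    moreover have "0 \<le> 1 / \<tau> * ((1 / 2 - 2 * \<theta>) * ?s)"
      using \<theta>_le h_low_pos \<rho>_low_pos assms(1) by (intro mult_nonneg_nonneg) auto
    ultimately show ?thesis
      by linarith
  qed
  with s assms(1) have \<alpha>: "0 < \<alpha>"
    by (simp add: \<alpha>_def)
  moreover have "\<bar>step_off (1 / \<tau>) \<sigma> (Suc j)\<bar> + \<alpha> \<le> step_diag (1 / \<tau>) \<sigma> (Suc j)" for j
  proof -
    let ?m = "step x (Suc j) * \<rho>h (Suc j)" and ?n = "step x (Suc j) * ch (Suc j)"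
    have m: "?s \<le> ?m"
      using h_low_le[of j] \<rho>_low_le[of j] h_low_pos \<rho>_low_pos step_pos[of j] by (intro mult_mono) auto
    have n: "0 \<le> ?n"
      using step_pos[of j] c_nonneg[of j] by simp
    have b: "\<nu> / H \<le> stiff_diag x bh (Suc j)"
      unfolding stiff_diag_def using \<nu>_le[of j] b_pos[of j] step_pos[of j] H(2)[of "Suc j"] \<nu>_pos
      by (intro frac_le) auto
    have "\<alpha> \<le> 1 / \<tau> * (1 / 2 * ?s)"
      by (simp add: \<alpha>_def)
    also have "\<dots> \<le> 1 / \<tau> * (1 / 2 * ?m) + \<sigma> * (1 / 2 * ?n)"
      using m mult_left_mono[OF m, of "1 / \<tau> * (1 / 2)"] mult_nonneg_nonneg[OF assms(2) n] assms(1)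
      by (simp add: mult.assoc)
    also have "\<dots> = step_diag (1 / \<tau>) \<sigma> (Suc j) + step_off (1 / \<tau>) \<sigma> (Suc j)"
      unfolding step_diag_def step_off_def elliptic_diag_def elliptic_off_def mass_diag_def mass_off_def
      by (simp add: algebra_simps)
    finally have plus: "\<alpha> \<le> step_diag (1 / \<tau>) \<sigma> (Suc j) + step_off (1 / \<tau>) \<sigma> (Suc j)" .
    have "\<alpha> \<le> 1 / \<tau> * ((1 / 2 - 2 * \<theta>) * ?s) + \<sigma> * (2 * \<nu> / H)"
      by (simp add: \<alpha>_def)
    also have "\<dots> \<le> 1 / \<tau> * ((1 / 2 - 2 * \<theta>) * ?m)
        + \<sigma> * (2 * stiff_diag x bh (Suc j) + (1 / 2 - 2 * \<theta>) * ?n)"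
    proof (intro add_mono mult_left_mono m)
      have "0 \<le> (1 / 2 - 2 * \<theta>) * ?n"
        using \<theta>_le n by (intro mult_nonneg_nonneg[of "1 / 2 - 2 * \<theta>" ?n]) auto
      with b show "2 * \<nu> / H \<le> 2 * stiff_diag x bh (Suc j) + (1 / 2 - 2 * \<theta>) * ?n"
        by simp
    qed (use \<theta>_le assms in auto)
    also have "\<dots> = step_diag (1 / \<tau>) \<sigma> (Suc j) - step_off (1 / \<tau>) \<sigma> (Suc j)"
      unfolding step_diag_def step_off_def elliptic_diag_def elliptic_off_def mass_diag_def mass_off_def
      by (simp add: algebra_simps)
    finally show ?thesis
      using plus by linarith
  qed
  ultimately show thesis
    by (rule that)
qed

lemma time_step_solvable:
  assumes "0 < \<tau>" "0 \<le> \<sigma>" "\<not> (\<sigma> = 0 \<and> \<theta> = 1 / 4)" "U' \<in> H_space"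
    and "square_summable (\<lambda>j. step_half x (Suc j) * f (Suc j))"
  obtains U where "U \<in> H_space"
    "\<And>j. C_op x \<theta> \<rho>h (\<lambda>i. (U i - U' i) / \<tau>) (Suc j)
        + A_op x \<theta> bh ch (\<lambda>i. \<sigma> * U i + (1 - \<sigma>) * U' i) (Suc j) = f (Suc j)"
proof -
  obtain \<alpha> where \<alpha>: "0 < \<alpha>"
      "\<And>j. \<bar>step_off (1 / \<tau>) \<sigma> (Suc j)\<bar> + \<alpha> \<le> step_diag (1 / \<tau>) \<sigma> (Suc j)"
    using step_coeffs_coercive[OF assms(1-3)] by blast
  let ?G = "\<lambda>j. step_half x j * f j
       + cell_op (step_diag (1 / \<tau>) (\<sigma> - 1)) (step_off (1 / \<tau>) (\<sigma> - 1)) U' j"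
  have "square_summable U'"
    using assms by (simp add: H_space_iff)
  then have "square_summable ?G"
    using assms(5) square_summable_Suc[of "\<lambda>j. step_half x j * f j"]
    by (intro square_summable_add square_summable_cell_op Bseq_step_coeffs) auto
  then obtain U where "U \<in> H_space"
      "\<And>j. j \<ge> 1 \<Longrightarrow> cell_op (step_diag (1 / \<tau>) \<sigma>) (step_off (1 / \<tau>) \<sigma>) U j = ?G j"
    using coercive_cell_system_solvable[OF Bseq_step_coeffs \<alpha>(1)
        cell_form_coercive[OF Bseq_step_coeffs _ less_imp_le[OF \<alpha>(1)] \<alpha>(2)]] by blast
  then show thesis
    by (intro that[of U]) (auto simp: scheme_row_iff)
qed

lemma time_step_unique:
  assumes "0 < \<tau>" "0 \<le> \<sigma>" "U \<in> H_space" "V \<in> H_space"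
    and "\<And>j. C_op x \<theta> \<rho>h (\<lambda>i. (U i - U' i) / \<tau>) (Suc j)
        + A_op x \<theta> bh ch (\<lambda>i. \<sigma> * U i + (1 - \<sigma>) * U' i) (Suc j) = f (Suc j)"
    and "\<And>j. C_op x \<theta> \<rho>h (\<lambda>i. (V i - U' i) / \<tau>) (Suc j)
        + A_op x \<theta> bh ch (\<lambda>i. \<sigma> * V i + (1 - \<sigma>) * U' i) (Suc j) = f (Suc j)"
  shows "U = V"
proof
  fix i
  let ?D = "step_diag (1 / \<tau>) \<sigma>" and ?E = "step_off (1 / \<tau>) \<sigma>"
  let ?W = "\<lambda>i. 1 * U i + (-1) * V i"
  have W: "?W \<in> H_space"
    by (rule H_space_lincomb[OF assms(3,4)])
  have "cell_op ?D ?E ?W (Suc j) = 0" for j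
    unfolding cell_op_lincomb using assms(5)[of j] assms(6)[of j] by (simp add: scheme_row_iff)
  then have "cell_form ?D ?E ?W ?W = 0"
    using suminf_cell_op[OF Bseq_step_coeffs W, of ?W "1 / \<tau>" \<sigma> "1 / \<tau>" \<sigma>] W
    by (simp add: H_space_iff)
  then have "?W i = 0"
    by (intro cell_form_eq_0_imp_zero[OF Bseq_step_coeffs W step_coeffs_dominance])
       (use assms in auto)
  then show "U i = V i"
    by simp
qed

text \<open>
  The scheme is tested with \<open>V = \<sigma> U + (1 - \<sigma>) U' = (U + U')/2 + (\<sigma> - 1/2) \<tau> dU\<close>.  Against \<open>dU\<close> the
  mean yields the increment of the squared norm, and the remainder yields the dissipation with
  factor \<open>\<sigma> - 1/2\<close>.
\<close>

lemma time_step_energy: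
  assumes "0 < \<tau>" "U \<in> H_space" "U' \<in> H_space" "square_summable f0" "square_summable f1"
    and V: "V = (\<lambda>i. \<sigma> * U i + (1 - \<sigma>) * U' i)" and dU: "dU = (\<lambda>i. (U i - U' i) / \<tau>)"
    and eq: "\<And>j. C_op x \<theta> \<rho>h dU (Suc j) + A_op x \<theta> bh ch V (Suc j) = f0 (Suc j) + dx_hat x f1 (Suc j)"
  shows "(norm_C x \<theta> \<rho>h U)\<^sup>2
      + 2 * ((\<sigma> - 1 / 2) * \<tau> * (norm_C x \<theta> \<rho>h dU)\<^sup>2 * \<tau> + (norm_L x \<theta> bh ch V)\<^sup>2 * \<tau>)
    = (norm_C x \<theta> \<rho>h U')\<^sup>2 + 2 * (inner_H x f0 V - inner_Ht x f1 (dx_bar x V)) * \<tau>"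
proof -
  have dU': "dU = (\<lambda>i. (1 / \<tau>) * U i + (- (1 / \<tau>)) * U' i)"
    by (simp add: dU fun_eq_iff diff_divide_distrib)
  have H: "V \<in> H_space" "dU \<in> H_space"
    unfolding V dU' by (intro H_space_lincomb assms)+
  have sq: "square_summable U" "square_summable U'" "square_summable V" "square_summable dU"
    using assms(2,3) H by (auto simp: H_space_iff)
  have B: "Bseq (mass_diag x \<theta> \<rho>h)" "Bseq (mass_off x \<theta> \<rho>h)"
          "Bseq (elliptic_diag x \<theta> bh ch)" "Bseq (elliptic_off x \<theta> bh ch)"
    by (intro Bseq_mass Bseq_elliptic Bseq_\<rho> Bseq_b Bseq_c)+
  have VS: "square_summable (\<lambda>j. V (Suc j))"
    using sq by simp
  let ?C = "cell_op (mass_diag x \<theta> \<rho>h) (mass_off x \<theta> \<rho>h) dU"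
  let ?A = "cell_op (elliptic_diag x \<theta> bh ch) (elliptic_off x \<theta> bh ch) V"
  have q: "square_summable (\<lambda>j. ?C (Suc j))" "square_summable (\<lambda>j. ?A (Suc j))"
    using square_summable_cell_op[OF B(1,2) sq(4)] square_summable_cell_op[OF B(3,4) sq(3)] by simp_all
  have s1: "summable (\<lambda>j. V (Suc j) * ?C (Suc j))" "summable (\<lambda>j. V (Suc j) * ?A (Suc j))"
    by (rule summable_mult_square_summable[OF VS q(1)], rule summable_mult_square_summable[OF VS q(2)])
  have "Bseq (\<lambda>j. step_half x (Suc j))" "square_summable (\<lambda>j. f0 (Suc j))"
    using Bseq_step_half assms by (simp_all add: Bseq_Suc_iff)
  from summable_mult_square_summable[OF square_summable_Bseq_mult[OF this] VS]
  have s2: "summable (\<lambda>j. f0 (Suc j) * V (Suc j) * step_half x (Suc j))"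
    by (simp add: mult_ac)
  from summable_mult_square_summable[OF square_summable_dx_hat[OF assms(5)] VS]
  have s3: "summable (\<lambda>j. dx_hat x f1 (Suc j) * V (Suc j) * step_half x (Suc j))"
    by (simp add: mult_ac)
  have "C_form V dU + elliptic_form V V
      = (\<Sum>j. V (Suc j) * ?C (Suc j) + V (Suc j) * ?A (Suc j))"
    using suminf_cell_op[OF B(1,2) H(1) sq(4)] suminf_cell_op[OF B(3,4) H(1) sq(3)]
      suminf_add[OF s1] by simp
  also have "\<dots> = (\<Sum>j. f0 (Suc j) * V (Suc j) * step_half x (Suc j)
      + dx_hat x f1 (Suc j) * V (Suc j) * step_half x (Suc j))"
  proof (intro suminf_cong)
    fix j
    have "V (Suc j) * ?C (Suc j) + V (Suc j) * ?A (Suc j)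
      = V (Suc j) * step_half x (Suc j) * (C_op x \<theta> \<rho>h dU (Suc j) + A_op x \<theta> bh ch V (Suc j))"
      unfolding step_half_C_op[symmetric] step_half_A_op[symmetric] by (simp add: algebra_simps)
    then show "V (Suc j) * ?C (Suc j) + V (Suc j) * ?A (Suc j)
      = f0 (Suc j) * V (Suc j) * step_half x (Suc j)
        + dx_hat x f1 (Suc j) * V (Suc j) * step_half x (Suc j)"
      unfolding eq by (simp add: algebra_simps)
  qed
  also have "\<dots> = inner_H x f0 V + inner_H x (dx_hat x f1) V"
    unfolding inner_H_def using suminf_add[OF s2 s3] by simp
  finally have weak: "C_form V dU + elliptic_form V V = inner_H x f0 V - inner_Ht x f1 (dx_bar x V)"
    by (simp add: inner_H_dx_hat[OF assms(5) H(1)])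
  note lin = cell_form_lincomb_left[OF B(1,2) sq(1,2)]
  have sym: "C_form U' U = C_form U U'"
    by (rule cell_form_sym)
  have lV: "C_form V Y = \<sigma> * C_form U Y + (1 - \<sigma>) * C_form U' Y" if "square_summable Y" for Y
    unfolding V by (rule lin[OF that])
  have ldU: "\<tau> * C_form dU Y = C_form U Y - C_form U' Y" if "square_summable Y" for Y
    unfolding dU' lin[OF that] using assms(1) by (simp add: algebra_simps)
  have "2 * \<tau> * C_form V dU = 2 * (C_form U V - C_form U' V)"
    using ldU[OF sq(3)] cell_form_sym[of _ _ V dU] by simp
  also have "\<dots> = 2 * (\<sigma> * C_form U U + (1 - \<sigma>) * C_form U U' - \<sigma> * C_form U U' - (1 - \<sigma>) * C_form U' U')"
    using lV[OF sq(1)] lV[OF sq(2)] sym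
    by (simp add: cell_form_sym[of _ _ U V] cell_form_sym[of _ _ U' V])
  finally have e1: "2 * \<tau> * C_form V dU
    = 2 * (\<sigma> * C_form U U + (1 - \<sigma>) * C_form U U' - \<sigma> * C_form U U' - (1 - \<sigma>) * C_form U' U')" .
  have "\<tau> * C_form dU dU = C_form dU U - C_form dU U'"
    using ldU[OF sq(4)] cell_form_sym[of _ _ U dU] cell_form_sym[of _ _ U' dU] by simp
  then have "\<tau> * (\<tau> * C_form dU dU) = \<tau> * C_form dU U - \<tau> * C_form dU U'"
    by (simp add: right_diff_distrib)
  then have e2: "\<tau> * (\<tau> * C_form dU dU) = C_form U U - 2 * C_form U U' + C_form U' U'"
    using ldU[OF sq(1)] ldU[OF sq(2)] sym by simp
  have "(\<sigma> - 1 / 2) * \<tau> * C_form dU dU * \<tau> = (\<sigma> - 1 / 2) * (\<tau> * (\<tau> * C_form dU dU))"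
    by (simp add: mult_ac)
  then have e3: "(\<sigma> - 1 / 2) * \<tau> * C_form dU dU * \<tau>
      = (\<sigma> - 1 / 2) * (C_form U U - 2 * C_form U U' + C_form U' U')"
    unfolding e2 .
  have "2 * \<tau> * C_form V dU + 2 * \<tau> * elliptic_form V V
      = 2 * (inner_H x f0 V - inner_Ht x f1 (dx_bar x V)) * \<tau>"
    unfolding weak[symmetric] by (simp add: algebra_simps)
  then show ?thesis
    unfolding norm_C_sq[OF assms(2)] norm_C_sq[OF assms(3)] norm_C_sq[OF H(2)] norm_L_sq[OF H(1)] e3 e1
    by (simp add: algebra_simps)
qed

end

context parabolic_mesh
begin

section \<open>Energy over all time steps\<close>

definition energy_sum :: "(nat \<Rightarrow> real) \<Rightarrow> real \<Rightarrow> (nat \<Rightarrow> nat \<Rightarrow> real) \<Rightarrow> nat \<Rightarrow> real" where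
  "energy_sum t \<sigma> U M =
     (\<Sum>m=1..M. (\<sigma> - 1 / 2) * step t m * (norm_C x \<theta> \<rho>h (dt_bar t U m))\<^sup>2 * step t m)
     + (\<Sum>m=1..M. (norm_L x \<theta> bh ch (t_avg \<sigma> U m))\<^sup>2 * step t m)"

lemma norm_1_eq_sqrt_energy_sum: "norm_1 x t \<sigma> \<theta> \<rho>h bh ch M U = sqrt (energy_sum t \<sigma> U M)"
  by (simp add: norm_1_def energy_sum_def)

lemma energy_identity:
  assumes "\<And>m. 0 < step t (Suc m)" "\<And>m. U m \<in> H_space"
    and "\<And>m. m \<ge> 1 \<Longrightarrow> square_summable (F0 m)" "\<And>m. m \<ge> 1 \<Longrightarrow> square_summable (F1 m)"
    and "\<And>m j. m \<ge> 1 \<Longrightarrow> j \<ge> 1 \<Longrightarrow> C_op x \<theta> \<rho>h (dt_bar t U m) j + A_op x \<theta> bh ch (t_avg \<sigma> U m) j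
        = F0 m j + dx_hat x (F1 m) j"
  shows "(norm_C x \<theta> \<rho>h (U M))\<^sup>2 + 2 * energy_sum t \<sigma> U M = (norm_C x \<theta> \<rho>h (U 0))\<^sup>2
    + 2 * (\<Sum>m=1..M. (inner_H x (F0 m) (t_avg \<sigma> U m)
        - inner_Ht x (F1 m) (dx_bar x (t_avg \<sigma> U m))) * step t m)"
proof (induction M)
  case (Suc M)
  have "t_avg \<sigma> U (Suc M) = (\<lambda>i. \<sigma> * U (Suc M) i + (1 - \<sigma>) * U M i)"
       "dt_bar t U (Suc M) = (\<lambda>i. (U (Suc M) i - U M i) / step t (Suc M))"
    by (simp_all add: fun_eq_iff t_avg_def dt_bar_def)
  from time_step_energy[OF assms(1,2,2) assms(3,4) this assms(5)]
  have "(norm_C x \<theta> \<rho>h (U (Suc M)))\<^sup>2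
      + 2 * ((\<sigma> - 1 / 2) * step t (Suc M) * (norm_C x \<theta> \<rho>h (dt_bar t U (Suc M)))\<^sup>2 * step t (Suc M)
        + (norm_L x \<theta> bh ch (t_avg \<sigma> U (Suc M)))\<^sup>2 * step t (Suc M))
    = (norm_C x \<theta> \<rho>h (U M))\<^sup>2 + 2 * (inner_H x (F0 (Suc M)) (t_avg \<sigma> U (Suc M))
        - inner_Ht x (F1 (Suc M)) (dx_bar x (t_avg \<sigma> U (Suc M)))) * step t (Suc M)"
    by simp
  from this[unfolded mult.assoc[of 2]] Suc show ?case
    by (simp add: energy_sum_def)
qed (simp add: energy_sum_def)

lemma energy_sum_mono:
  assumes "\<And>m. 0 < step t (Suc m)" "1 / 2 \<le> \<sigma>" "m \<le> M"
  shows "energy_sum t \<sigma> U m \<le> energy_sum t \<sigma> U M"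
proof -
  have pos: "0 < step t i" if "1 \<le> i" for i
    using assms(1)[of "i - 1"] that by simp
  show ?thesis
    unfolding energy_sum_def
    by (intro add_mono sum_mono2)
       (use assms in \<open>auto intro!: mult_nonneg_nonneg less_imp_le[OF pos]\<close>)
qed

lemma energy_sum_ge:
  assumes "\<And>m. 0 < step t (Suc m)" "1 / 2 \<le> \<sigma>" "\<And>m. U m \<in> H_space"
  shows "\<nu> * (\<Sum>m=1..M. (norm_Ht x (dx_bar x (t_avg \<sigma> U m)))\<^sup>2 * step t m) \<le> energy_sum t \<sigma> U M"
proof -
  have pos: "0 < step t i" if "1 \<le> i" for i
    using assms(1)[of "i - 1"] that by simp
  have V: "t_avg \<sigma> U m \<in> H_space" for m
    unfolding t_avg_def[abs_def] by (intro H_space_lincomb assms)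
  have "\<nu> * (\<Sum>m=1..M. (norm_Ht x (dx_bar x (t_avg \<sigma> U m)))\<^sup>2 * step t m)
      = (\<Sum>m=1..M. \<nu> * (norm_Ht x (dx_bar x (t_avg \<sigma> U m)))\<^sup>2 * step t m)"
    by (simp add: sum_distrib_left mult.assoc)
  also have "\<dots> \<le> (\<Sum>m=1..M. (norm_L x \<theta> bh ch (t_avg \<sigma> U m))\<^sup>2 * step t m)"
    by (intro sum_mono mult_right_mono norm_Ht_dx_bar_le V less_imp_le[OF pos]) simp
  also have "\<dots> \<le> energy_sum t \<sigma> U M"
    unfolding energy_sum_def
    by (intro add_increasing sum_nonneg order_refl)
       (use assms in \<open>auto intro!: mult_nonneg_nonneg less_imp_le[OF pos]\<close>)
  finally show ?thesis .
qed

text \<open>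
  Expanding \<open>U\<^sup>(\<^sup>\<sigma>\<^sup>)\<close> before estimating produces the factor \<open>\<sigma> + \<bar>1 - \<sigma>\<bar>\<close> of \<open>K_const\<close>.  The constant
  \<open>\<kappa>\<close> covers both cases of the theorem: it is \<open>1 / sqrt (c_const \<theta> * \<rho>_low)\<close> for \<open>\<theta> < 1/4\<close>, and \<open>0\<close>
  for \<open>\<theta> = 1/4\<close> with vanishing \<open>F0\<close>, where the norms are no longer comparable.
\<close>

lemma F0_work_le:
  assumes "\<And>m. 0 < step t (Suc m)" "0 \<le> \<sigma>" "\<And>m. U m \<in> H_space"
    and "\<And>m. m \<ge> 1 \<Longrightarrow> square_summable (F0 m)" "0 \<le> \<kappa>"
    and "\<And>m W. m \<ge> 1 \<Longrightarrow> W \<in> H_space \<Longrightarrow>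
      \<bar>inner_H x (F0 m) W\<bar> \<le> \<kappa> * norm_H x (F0 m) * norm_C x \<theta> \<rho>h W"
    and "\<And>k. k \<le> m \<Longrightarrow> norm_C x \<theta> \<rho>h (U k) \<le> Y"
  shows "2 * (\<Sum>k=1..m. inner_H x (F0 k) (t_avg \<sigma> U k) * step t k)
    \<le> K_const \<sigma> * \<kappa> * (\<Sum>k=1..m. norm_H x (F0 k) * step t k) * Y"
proof -
  have pos: "0 < step t i" if "1 \<le> i" for i
    using assms(1)[of "i - 1"] that by simp
  define s where "s = \<sigma> + \<bar>1 - \<sigma>\<bar>"
  have one: "inner_H x (F0 k) (t_avg \<sigma> U k) \<le> s * (\<kappa> * norm_H x (F0 k) * Y)"
    if k: "1 \<le> k" "k \<le> m" for k
  proof -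
    have bound: "\<bar>inner_H x (F0 k) (U i)\<bar> \<le> \<kappa> * norm_H x (F0 k) * Y" if "i \<le> m" for i
      using assms(5,7) that k(1)
      by (intro order_trans[OF assms(6)[OF k(1) assms(3)]] mult_left_mono mult_nonneg_nonneg
          norm_H_nonneg assms(4)) auto
    have sq: "square_summable (U i)" for i
      using assms(3) by (simp add: H_space_iff)
    have "inner_H x (F0 k) (t_avg \<sigma> U k)
        = \<sigma> * inner_H x (F0 k) (U k) + (1 - \<sigma>) * inner_H x (F0 k) (U (k - 1))"
      unfolding t_avg_def[abs_def] by (intro inner_H_lincomb_right assms(4) k sq)
    also have "\<dots> \<le> \<sigma> * \<bar>inner_H x (F0 k) (U k)\<bar> + \<bar>1 - \<sigma>\<bar> * \<bar>inner_H x (F0 k) (U (k - 1))\<bar>"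
      using assms(2) by (intro add_mono mult_left_mono) (auto simp flip: abs_mult)
    also have "\<dots> \<le> \<sigma> * (\<kappa> * norm_H x (F0 k) * Y) + \<bar>1 - \<sigma>\<bar> * (\<kappa> * norm_H x (F0 k) * Y)"
      using assms(2) k by (intro add_mono mult_left_mono bound) auto
    finally show ?thesis
      by (simp only: distrib_right s_def)
  qed
  have "2 * (\<Sum>k=1..m. inner_H x (F0 k) (t_avg \<sigma> U k) * step t k)
      \<le> 2 * (\<Sum>k=1..m. s * (\<kappa> * norm_H x (F0 k) * Y) * step t k)"
    by (intro mult_left_mono sum_mono mult_right_mono one less_imp_le[OF pos]) auto
  also have "\<dots> = K_const \<sigma> * \<kappa> * (\<Sum>k=1..m. norm_H x (F0 k) * step t k) * Y"
    unfolding K_const_def s_def[symmetric]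
    by (simp add: sum_distrib_left sum_distrib_right mult_ac)
  finally show ?thesis .
qed

text \<open>
  The gradient of \<open>U\<^sup>(\<^sup>\<sigma>\<^sup>)\<close> is controlled by the elliptic part of the energy at the price of
  \<open>1 / sqrt \<nu>\<close>.  The factor \<open>2\<close> is split evenly between \<open>sqrt (2 / \<nu>)\<close> and the quantity
  \<open>sqrt (2 E)\<close> that appears in the bound.
\<close>

lemma F1_work_le:
  assumes "\<And>m. 0 < step t (Suc m)" "1 / 2 \<le> \<sigma>" "\<And>m. U m \<in> H_space"
    and "\<And>m. m \<ge> 1 \<Longrightarrow> square_summable (F1 m)" "m \<le> M"
  shows "- 2 * (\<Sum>k=1..m. inner_Ht x (F1 k) (dx_bar x (t_avg \<sigma> U k)) * step t k)
    \<le> sqrt (2 / \<nu>) * sqrt (\<Sum>k=1..M. (norm_Ht x (F1 k))\<^sup>2 * step t k)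
      * (sqrt 2 * sqrt (energy_sum t \<sigma> U M))"
proof -
  have pos: "0 < step t i" if "1 \<le> i" for i
    using assms(1)[of "i - 1"] that by simp
  have V: "square_summable (t_avg \<sigma> U m)" for m
    using H_space_lincomb[OF assms(3,3)] by (simp add: t_avg_def[abs_def] H_space_iff)
  let ?f = "\<lambda>k. norm_Ht x (F1 k)" and ?g = "\<lambda>k. norm_Ht x (dx_bar x (t_avg \<sigma> U k))"
  have fg: "0 \<le> ?f k" "0 \<le> ?g k" if "1 \<le> k" for k
    by (intro norm_Ht_nonneg square_summable_dx_bar V assms(4) that)+
  have CS: "(\<Sum>k=1..M. ?f k * ?g k * step t k)
      \<le> sqrt (\<Sum>k=1..M. (?f k)\<^sup>2 * step t k) * sqrt (\<Sum>k=1..M. (?g k)\<^sup>2 * step t k)"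
  proof -
    have "(\<Sum>k=1..M. ?f k * ?g k * step t k)\<^sup>2
        = (\<Sum>k=1..M. (?f k * sqrt (step t k)) * (?g k * sqrt (step t k)))\<^sup>2"
      by (intro arg_cong[where f = "\<lambda>y. y\<^sup>2"] sum.cong) (auto simp: mult_ac less_imp_le[OF pos])
    also have "\<dots> \<le> (\<Sum>k=1..M. (?f k * sqrt (step t k))\<^sup>2) * (\<Sum>k=1..M. (?g k * sqrt (step t k))\<^sup>2)"
      by (rule Cauchy_Schwarz_ineq_sum)
    also have "\<dots> = (\<Sum>k=1..M. (?f k)\<^sup>2 * step t k) * (\<Sum>k=1..M. (?g k)\<^sup>2 * step t k)"
      by (intro arg_cong2[where f = "(*)"] sum.cong)
         (auto simp: power_mult_distrib less_imp_le[OF pos])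
    finally show ?thesis
      unfolding real_sqrt_mult[symmetric] by (rule real_le_rsqrt)
  qed
  have "sqrt (\<Sum>k=1..M. (?g k)\<^sup>2 * step t k) \<le> sqrt (energy_sum t \<sigma> U M / \<nu>)"
    using energy_sum_ge[OF assms(1-3), where M = M] \<nu>_pos
    by (intro real_sqrt_le_mono) (simp only: pos_le_divide_eq mult.commute)
  then have "sqrt (\<Sum>k=1..M. (?f k)\<^sup>2 * step t k) * sqrt (\<Sum>k=1..M. (?g k)\<^sup>2 * step t k)
      \<le> sqrt (\<Sum>k=1..M. (?f k)\<^sup>2 * step t k) * sqrt (energy_sum t \<sigma> U M / \<nu>)"
    by (rule mult_left_mono) (auto intro!: real_sqrt_ge_zero sum_nonneg simp: less_imp_le[OF pos])
  note CS = order_trans[OF CS this]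
  have "- 2 * (\<Sum>k=1..m. inner_Ht x (F1 k) (dx_bar x (t_avg \<sigma> U k)) * step t k)
      = 2 * (\<Sum>k=1..m. - inner_Ht x (F1 k) (dx_bar x (t_avg \<sigma> U k)) * step t k)"
    by (simp add: sum_negf)
  also have "\<dots> \<le> 2 * (\<Sum>k=1..m. ?f k * ?g k * step t k)"
  proof (intro mult_left_mono sum_mono mult_right_mono less_imp_le[OF pos])
    fix k assume "k \<in> {1..m}"
    then show "- inner_Ht x (F1 k) (dx_bar x (t_avg \<sigma> U k)) \<le> ?f k * ?g k"
      using inner_Ht_le[OF assms(4) square_summable_dx_bar[OF V], of k k] by simp
  qed auto
  also have "\<dots> \<le> 2 * (\<Sum>k=1..M. ?f k * ?g k * step t k)"
    by (intro mult_left_mono sum_mono2)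
       (use assms(5) in \<open>auto intro!: mult_nonneg_nonneg fg less_imp_le[OF pos]\<close>)
  also have "\<dots> \<le> 2 * (sqrt (\<Sum>k=1..M. (?f k)\<^sup>2 * step t k) * sqrt (energy_sum t \<sigma> U M / \<nu>))"
    by (rule mult_left_mono[OF CS]) simp
  also have "\<dots> = (sqrt 2 * sqrt 2) * (sqrt (\<Sum>k=1..M. (?f k)\<^sup>2 * step t k) * sqrt (energy_sum t \<sigma> U M / \<nu>))"
    by simp
  also have "\<dots> = sqrt (2 / \<nu>) * sqrt (\<Sum>k=1..M. (?f k)\<^sup>2 * step t k) * (sqrt 2 * sqrt (energy_sum t \<sigma> U M))"
    unfolding real_sqrt_divide by (simp add: mult_ac)
  finally show ?thesis .
qed

text \<open>
  The maximum \<open>N\<close> of the two left-hand quantities satisfies a quadratic inequality that is homogeneous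
  after one use of \<open>\<parallel>U\<^sup>0\<parallel> \<le> N\<close>, so no constant is lost by cancelling \<open>N\<close>.
\<close>

lemma a_priori_bound:
  assumes "\<And>m. 0 < step t (Suc m)" "1 / 2 \<le> \<sigma>" "\<And>m. U m \<in> H_space"
    and "\<And>m. m \<ge> 1 \<Longrightarrow> square_summable (F0 m)" "\<And>m. m \<ge> 1 \<Longrightarrow> square_summable (F1 m)"
    and "\<And>m j. m \<ge> 1 \<Longrightarrow> j \<ge> 1 \<Longrightarrow> C_op x \<theta> \<rho>h (dt_bar t U m) j + A_op x \<theta> bh ch (t_avg \<sigma> U m) j
        = F0 m j + dx_hat x (F1 m) j"
    and "0 \<le> \<kappa>" "\<And>m W. m \<ge> 1 \<Longrightarrow> W \<in> H_space \<Longrightarrow>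
      \<bar>inner_H x (F0 m) W\<bar> \<le> \<kappa> * norm_H x (F0 m) * norm_C x \<theta> \<rho>h W"
  shows "max (Max ((\<lambda>m. norm_C x \<theta> \<rho>h (U m)) ` {0..M})) (sqrt 2 * norm_1 x t \<sigma> \<theta> \<rho>h bh ch M U)
    \<le> norm_C x \<theta> \<rho>h (U 0) + K_const \<sigma> * \<kappa> * (\<Sum>m=1..M. norm_H x (F0 m) * step t m)
      + sqrt (2 / \<nu>) * sqrt (\<Sum>m=1..M. (norm_Ht x (F1 m))\<^sup>2 * step t m)"
proof -
  let ?nC = "\<lambda>m. norm_C x \<theta> \<rho>h (U m)"
  define Y where "Y = Max (?nC ` {0..M})"
  define Q where "Q = sqrt 2 * sqrt (energy_sum t \<sigma> U M)"
  define N where "N = max Y Q"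
  define p where "p = K_const \<sigma> * \<kappa> * (\<Sum>m=1..M. norm_H x (F0 m) * step t m)"
  define g where "g = sqrt (2 / \<nu>) * sqrt (\<Sum>m=1..M. (norm_Ht x (F1 m))\<^sup>2 * step t m)"
  have pos: "0 < step t i" if "1 \<le> i" for i
    using assms(1)[of "i - 1"] that by simp
  have K: "0 \<le> K_const \<sigma> * \<kappa>"
    using assms(2,7) by (simp add: K_const_def)
  have le_Y: "?nC m \<le> Y" if "m \<le> M" for m
    unfolding Y_def using that by (intro Max_ge) auto
  have Y: "0 \<le> Y"
    using order_trans[OF norm_C_nonneg[OF assms(3)] le_Y[of 0]] by simp
  have E: "0 \<le> energy_sum t \<sigma> U m" for m
    using energy_sum_mono[OF assms(1,2), of 0 m U] by (simp add: energy_sum_def)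
  have Q: "0 \<le> Q" "Q\<^sup>2 = 2 * energy_sum t \<sigma> U M"
    using E by (simp_all add: Q_def power_mult_distrib)
  have g: "0 \<le> g"
    unfolding g_def using \<nu>_pos
    by (intro mult_nonneg_nonneg real_sqrt_ge_zero sum_nonneg less_imp_le[OF pos]) auto
  have p: "0 \<le> p"
    unfolding p_def by (intro mult_nonneg_nonneg K sum_nonneg norm_H_nonneg assms(4) less_imp_le[OF pos]) auto
  have energy: "(?nC m)\<^sup>2 + 2 * energy_sum t \<sigma> U m \<le> (?nC 0)\<^sup>2 + p * Y + g * Q" if "m \<le> M" for m
  proof -
    have "2 * (\<Sum>k=1..m. inner_H x (F0 k) (t_avg \<sigma> U k) * step t k)
        \<le> K_const \<sigma> * \<kappa> * (\<Sum>k=1..m. norm_H x (F0 k) * step t k) * Y"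
      using assms(2) that by (intro F0_work_le assms le_Y) auto
    also have "\<dots> \<le> p * Y"
      unfolding p_def
      by (intro mult_right_mono mult_left_mono sum_mono2 K Y)
         (use that in \<open>auto intro!: mult_nonneg_nonneg norm_H_nonneg assms(4) less_imp_le[OF pos]\<close>)
    finally have "2 * (\<Sum>k=1..m. inner_H x (F0 k) (t_avg \<sigma> U k) * step t k) \<le> p * Y" .
    moreover have "- 2 * (\<Sum>k=1..m. inner_Ht x (F1 k) (dx_bar x (t_avg \<sigma> U k)) * step t k) \<le> g * Q"
      unfolding g_def Q_def by (intro F1_work_le assms that)
    moreover have "(?nC m)\<^sup>2 + 2 * energy_sum t \<sigma> U m = (?nC 0)\<^sup>2
        + 2 * (\<Sum>k=1..m. (inner_H x (F0 k) (t_avg \<sigma> U k)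
          - inner_Ht x (F1 k) (dx_bar x (t_avg \<sigma> U k))) * step t k)"
      by (intro energy_identity assms)
    ultimately show ?thesis
      by (simp add: left_diff_distrib sum_subtractf right_diff_distrib)
  qed
  have "Y \<in> ?nC ` {0..M}"
    unfolding Y_def by (intro Max_in) auto
  then obtain m where m: "m \<le> M" "Y = ?nC m"
    by auto
  \<comment> \<open>If \<open>Y\<close> dominates, the identity is read at the time \<open>m\<close> where \<open>Y\<close> is attained, otherwise at \<open>M\<close>.\<close>
  have "N\<^sup>2 \<le> (?nC 0)\<^sup>2 + p * Y + g * Q"
  proof (cases "Q \<le> Y")
    case True
    then show ?thesis
      using energy[OF m(1)] E[of m] m(2) by (simp add: N_def max_def)
  next
    case False
    then have "N = Q"
      by (simp add: N_def)
    then have "N\<^sup>2 = 2 * energy_sum t \<sigma> U M"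
      by (simp only: Q(2))
    with energy[OF order_refl] zero_le_power2[of "?nC M"] show ?thesis
      by linarith
  qed
  also have "\<dots> \<le> ?nC 0 * N + p * N + g * N"
    unfolding power2_eq_square N_def using le_Y[of 0] norm_C_nonneg[OF assms(3), of 0] p g
    by (intro add_mono mult_left_mono) auto
  finally have "N * N \<le> (?nC 0 + p + g) * N"
    by (simp add: power2_eq_square distrib_right)
  then have "N \<le> ?nC 0 + p + g"
  proof (cases "0 < N")
    case False
    then show ?thesis
      using norm_C_nonneg[OF assms(3), of 0] p g by linarith
  qed simp
  then show ?thesis
    unfolding norm_1_eq_sqrt_energy_sum N_def Y_def Q_def p_def g_def .
qed

lemma scheme_solution_exists:
  assumes "\<And>m. 0 < step t (Suc m)" "0 \<le> \<sigma>" "\<not> (\<sigma> = 0 \<and> \<theta> = 1 / 4)" "U0 \<in> H_space"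
    and "\<And>m. m \<ge> 1 \<Longrightarrow> square_summable (\<lambda>j. step_half x (Suc j) * F m (Suc j))"
  shows "\<exists>U. scheme_solution x t \<sigma> \<theta> \<rho>h bh ch F U0 U \<and> (\<forall>m. U m \<in> H_space)"
proof -
  have "\<exists>U. \<forall>m. (U m \<in> H_space \<and> (m = 0 \<longrightarrow> U m = U0)) \<and>
      (\<forall>j. C_op x \<theta> \<rho>h (\<lambda>i. (U (Suc m) i - U m i) / step t (Suc m)) (Suc j)
        + A_op x \<theta> bh ch (\<lambda>i. \<sigma> * U (Suc m) i + (1 - \<sigma>) * U m i) (Suc j) = F (Suc m) (Suc j))"
  proof (rule dependent_nat_choice)
    show "\<exists>V. V \<in> H_space \<and> (0 = 0 \<longrightarrow> V = U0)"
      using assms(4) by auto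
    fix V and m :: nat
    assume "V \<in> H_space \<and> (m = 0 \<longrightarrow> V = U0)"
    then obtain W where "W \<in> H_space"
        "\<And>j. C_op x \<theta> \<rho>h (\<lambda>i. (W i - V i) / step t (Suc m)) (Suc j)
        + A_op x \<theta> bh ch (\<lambda>i. \<sigma> * W i + (1 - \<sigma>) * V i) (Suc j) = F (Suc m) (Suc j)"
      using time_step_solvable[OF assms(1-3), of V "F (Suc m)" m] assms(5)[of "Suc m"] by auto
    then show "\<exists>W. (W \<in> H_space \<and> (Suc m = 0 \<longrightarrow> W = U0)) \<and>
        (\<forall>j. C_op x \<theta> \<rho>h (\<lambda>i. (W i - V i) / step t (Suc m)) (Suc j)
        + A_op x \<theta> bh ch (\<lambda>i. \<sigma> * W i + (1 - \<sigma>) * V i) (Suc j) = F (Suc m) (Suc j))"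
      by auto
  qed
  then obtain U where U: "\<And>m. U m \<in> H_space" "U 0 = U0"
      "\<And>m j. C_op x \<theta> \<rho>h (\<lambda>i. (U (Suc m) i - U m i) / step t (Suc m)) (Suc j)
        + A_op x \<theta> bh ch (\<lambda>i. \<sigma> * U (Suc m) i + (1 - \<sigma>) * U m i) (Suc j) = F (Suc m) (Suc j)"
    by blast
  have "C_op x \<theta> \<rho>h (dt_bar t U m) j + A_op x \<theta> bh ch (t_avg \<sigma> U m) j = F m j"
    if "m \<ge> 1" "j \<ge> 1" for m j
    using U(3)[of "m - 1" "j - 1"] that by (simp add: dt_bar_def[abs_def] t_avg_def[abs_def])
  with U show ?thesis
    by (intro exI[of _ U]) (auto simp: scheme_solution_def H_space_iff)
qed

lemma scheme_solution_unique:
  assumes "\<And>m. 0 < step t (Suc m)" "0 \<le> \<sigma>"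
    and "scheme_solution x t \<sigma> \<theta> \<rho>h bh ch F U0 U" "\<And>m. U m \<in> H_space"
    and "scheme_solution x t \<sigma> \<theta> \<rho>h bh ch F U0 V" "\<And>m. V m \<in> H_space"
  shows "U = V"
proof
  fix m
  have row: "C_op x \<theta> \<rho>h (\<lambda>i. (W (Suc m) i - W m i) / step t (Suc m)) (Suc j)
      + A_op x \<theta> bh ch (\<lambda>i. \<sigma> * W (Suc m) i + (1 - \<sigma>) * W m i) (Suc j) = F (Suc m) (Suc j)"
    if "scheme_solution x t \<sigma> \<theta> \<rho>h bh ch F U0 W" for W m j
  proof -
    have "C_op x \<theta> \<rho>h (dt_bar t W (Suc m)) (Suc j) + A_op x \<theta> bh ch (t_avg \<sigma> W (Suc m)) (Suc j)
        = F (Suc m) (Suc j)"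
      using that by (simp add: scheme_solution_def)
    then show ?thesis
      by (simp add: dt_bar_def[abs_def] t_avg_def[abs_def])
  qed
  show "U m = V m"
  proof (induction m)
    case 0
    show ?case
      using assms(3,5) by (simp add: scheme_solution_def)
  next
    case (Suc m)
    show ?case
      using row[OF assms(3), of m] row[OF assms(5), of m] unfolding Suc.IH
      by (rule time_step_unique[OF assms(1,2,4,6)])
  qed
qed

end

section \<open>Eventually uniform meshes and eventually constant coefficients\<close>

text \<open>
  Only finitely many different steps occur, so they have a positive minimum and a maximum.
\<close>

lemma regular_mesh_of_eventually_uniform:
  assumes "strict_mono x" "\<forall>j\<ge>J. step x j = step x J"
  shows "\<exists>h_low. regular_mesh x h_low"
proof -
  define S where "S = (\<lambda>j. step x (Suc j)) ` {..J}"
  have in_S: "step x (Suc j) \<in> S" for j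
  proof (cases "j \<le> J")
    case False
    then have "step x (Suc j) = step x (Suc J)"
      using assms(2) by (metis le_SucI nat_le_linear order_refl)
    then show ?thesis
      by (auto simp: S_def)
  qed (auto simp: S_def)
  have S: "finite S" "\<And>s. s \<in> S \<Longrightarrow> 0 < s"
    using assms(1) by (auto simp: S_def step_def strict_mono_def)
  have "Min S \<in> S"
    using S(1) in_S[of 0] by (intro Min_in) auto
  then have Min_pos: "0 < Min S"
    by (rule S(2))
  have "Bseq (\<lambda>j. step x (Suc j))"
  proof (rule BseqI')
    show "norm (step x (Suc j)) \<le> Max S" for j
      using S(2)[OF in_S[of j]] Max_ge[OF S(1) in_S[of j]] by simp
  qed
  then have "regular_mesh x (Min S)"
    using Min_pos Min_le[OF S(1) in_S] by unfold_locales (simp_all only: Bseq_Suc_iff)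
  then show ?thesis
    by blast
qed

text \<open>
  From the cell after node \<open>J\<close> on, the midpoints lie in the region where the coefficient is
  constant.
\<close>

lemma Bseq_mesh_coeff:
  assumes "strict_mono x" "x J \<ge> X0" "\<forall>y\<ge>X0. k y = k_inf"
  shows "Bseq (mesh_coeff x k)"
proof -
  have "mesh_coeff x k j = k_inf" if "j \<ge> Suc J" for j
  proof -
    have "x J \<le> x (j - 1)" "x J \<le> x j"
      using assms(1) that by (auto simp: strict_mono_less_eq)
    then show ?thesis
      using assms(2,3) by (simp add: mesh_coeff_def midpt_def)
  qed
  then have "Bseq (\<lambda>j. mesh_coeff x k (j + Suc J))"
    by (intro BseqI'[where K = "\<bar>k_inf\<bar>"]) simp
  then show ?thesis
    by (rule Bseq_offset)
qed

lemma midpt_pos: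
  assumes "strict_mono x" "x 0 = 0"
  shows "0 < midpt x (Suc j)"
proof -
  have "x 0 \<le> x j" "x j < x (Suc j)"
    using assms(1) by (auto simp: strict_mono_less_eq strict_mono_less)
  with assms(2) show ?thesis
    by (simp add: midpt_def)
qed

section \<open>Well-posedness and the a priori bound\<close>

theorem proposition3:
  fixes \<rho> b c :: "real \<Rightarrow> real"
    and \<rho>_low \<nu> X0 X \<rho>_inf b_inf c_inf \<sigma> \<theta> :: real
    and x t :: "nat \<Rightarrow> real" and J :: nat
    and F F0 F1 :: "nat \<Rightarrow> nat \<Rightarrow> real" and U\<^sub>h :: "nat \<Rightarrow> real"
    and \<rho>h bh ch :: "nat \<Rightarrow> real"
  assumes "continuous_on {0<..} \<rho>" "continuous_on {0<..} b" "continuous_on {0<..} c"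
    and "\<rho>_low > 0" "\<forall>y>0. \<rho> y \<ge> \<rho>_low"
    and "\<nu> > 0" "\<forall>y>0. b y \<ge> \<nu>"
    and "\<forall>y>0. c y \<ge> 0"
    and "X0 > 0" "\<rho>_inf > 0" "b_inf > 0" "c_inf \<ge> 0"
    and "\<forall>y\<ge>X0. \<rho> y = \<rho>_inf \<and> b y = b_inf \<and> c y = c_inf"
    and "X > X0"
    and "x 0 = 0" "strict_mono x" "J \<ge> 1" "x J = X"
    and "step x J \<le> X - X0" "\<forall>j\<ge>J. step x j = step x J"
    and "t 0 = 0" "strict_mono t" "filterlim t at_top sequentially"
    and "\<rho>h = mesh_coeff x \<rho>" "bh = mesh_coeff x b" "ch = mesh_coeff x c"
    and "\<forall>m\<ge>1. F0 m \<in> H_space" "\<forall>m\<ge>1. F1 m \<in> Ht_space"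
    and "\<forall>m\<ge>1. \<forall>j\<ge>1. F m j = F0 m j + dx_hat x (F1 m) j"
    and "U\<^sub>h \<in> H_space"
  shows
    "(\<sigma> \<ge> 0 \<and> \<theta> \<le> 1 / 4 \<and> \<not> (\<sigma> = 0 \<and> \<theta> = 1 / 4) \<longrightarrow>
        (\<exists>!U. scheme_solution x t \<sigma> \<theta> \<rho>h bh ch F U\<^sub>h U \<and> (\<forall>m. U m \<in> H_space)))
     \<and> (\<sigma> \<ge> 0 \<and> \<theta> \<le> 1 / 4 \<longrightarrow>
        (\<exists>\<^sub>\<le>\<^sub>1U. scheme_solution x t \<sigma> \<theta> \<rho>h bh ch F U\<^sub>h U \<and> (\<forall>m. U m \<in> H_space)))
     \<and> (\<sigma> \<ge> 1 / 2 \<and> \<theta> < 1 / 4 \<longrightarrow>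
        (\<forall>U. scheme_solution x t \<sigma> \<theta> \<rho>h bh ch F U\<^sub>h U \<and> (\<forall>m. U m \<in> H_space) \<longrightarrow>
          (\<forall>M\<ge>1.
            max (Max ((\<lambda>m. norm_C x \<theta> \<rho>h (U m)) ` {0..M}))
                (sqrt 2 * norm_1 x t \<sigma> \<theta> \<rho>h bh ch M U)
            \<le> norm_C x \<theta> \<rho>h U\<^sub>h
              + K_const \<sigma> / sqrt (c_const \<theta> * \<rho>_low) * (\<Sum>m=1..M. norm_H x (F0 m) * step t m)
              + sqrt (2 / \<nu>) * sqrt (\<Sum>m=1..M. (norm_Ht x (F1 m))\<^sup>2 * step t m))))
     \<and> (\<sigma> \<ge> 1 / 2 \<and> \<theta> = 1 / 4 \<and> (\<forall>m\<ge>1. \<forall>j. F0 m j = 0) \<longrightarrow>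
        (\<forall>U. scheme_solution x t \<sigma> \<theta> \<rho>h bh ch F U\<^sub>h U \<and> (\<forall>m. U m \<in> H_space) \<longrightarrow>
          (\<forall>M\<ge>1.
            max (Max ((\<lambda>m. norm_C x \<theta> \<rho>h (U m)) ` {0..M}))
                (sqrt 2 * norm_1 x t \<sigma> \<theta> \<rho>h bh ch M U)
            \<le> norm_C x \<theta> \<rho>h U\<^sub>h
              + sqrt (2 / \<nu>) * sqrt (\<Sum>m=1..M. (norm_Ht x (F1 m))\<^sup>2 * step t m))))"
proof -
  obtain h_low where "regular_mesh x h_low"
    using regular_mesh_of_eventually_uniform[OF assms(16,20)] ..
  then interpret regular_mesh x h_low .
  have XJ: "X0 \<le> x J"
    using assms(14,18) by simp
  have mid: "0 < midpt x (Suc j)" for j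
    by (rule midpt_pos[OF assms(16,15)])
  have mesh: "parabolic_mesh x h_low \<rho>h bh ch \<rho>_low \<nu> \<theta>" if "\<theta> \<le> 1 / 4"
  proof unfold_locales
    show "\<rho>_low \<le> \<rho>h (Suc j)" "\<nu> \<le> bh (Suc j)" "0 \<le> ch (Suc j)" for j
      using assms(5,7,8) mid[of j] by (auto simp: assms(24-26) mesh_coeff_def)
    show "Bseq \<rho>h" "Bseq bh" "Bseq ch"
      unfolding assms(24-26) using assms(13)
      by (auto intro!: Bseq_mesh_coeff[OF assms(16) XJ])
  qed (use assms(4,6) that in auto)
  have \<tau>: "0 < step t (Suc m)" for m
    using assms(22) by (simp add: step_def strict_mono_def)
  have F01: "square_summable (F0 m)" "square_summable (F1 m)" if "m \<ge> 1" for m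
    using assms(27,28) that by (auto simp: H_space_iff Ht_space_iff)
  have F: "square_summable (\<lambda>j. step_half x (Suc j) * F m (Suc j))" if "m \<ge> 1" for m
  proof -
    have "Bseq (\<lambda>j. step_half x (Suc j))" "square_summable (\<lambda>j. F0 m (Suc j))"
      using Bseq_step_half F01[OF that] by (simp_all add: Bseq_Suc_iff)
    from square_summable_add[OF square_summable_Bseq_mult[OF this] square_summable_dx_hat[OF F01(2)[OF that]]]
    show ?thesis
      using assms(29) that by (simp add: distrib_left)
  qed
  have unique: "U = V"
    if "\<sigma> \<ge> 0" "\<theta> \<le> 1 / 4"
      "scheme_solution x t \<sigma> \<theta> \<rho>h bh ch F U\<^sub>h U" "\<And>m. U m \<in> H_space"
      "scheme_solution x t \<sigma> \<theta> \<rho>h bh ch F U\<^sub>h V" "\<And>m. V m \<in> H_space" for U V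
    by (rule parabolic_mesh.scheme_solution_unique[OF mesh[OF that(2)] \<tau> that(1,3-6)])
  have bound: "max (Max ((\<lambda>m. norm_C x \<theta> \<rho>h (U m)) ` {0..M})) (sqrt 2 * norm_1 x t \<sigma> \<theta> \<rho>h bh ch M U)
      \<le> norm_C x \<theta> \<rho>h U\<^sub>h + K_const \<sigma> * \<kappa> * (\<Sum>m=1..M. norm_H x (F0 m) * step t m)
        + sqrt (2 / \<nu>) * sqrt (\<Sum>m=1..M. (norm_Ht x (F1 m))\<^sup>2 * step t m)"
    if "\<sigma> \<ge> 1 / 2" "\<theta> \<le> 1 / 4" "0 \<le> \<kappa>"
      and sol: "scheme_solution x t \<sigma> \<theta> \<rho>h bh ch F U\<^sub>h U \<and> (\<forall>m. U m \<in> H_space)"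
      and \<kappa>: "\<And>m W. m \<ge> 1 \<Longrightarrow> W \<in> H_space \<Longrightarrow>
        \<bar>inner_H x (F0 m) W\<bar> \<le> \<kappa> * norm_H x (F0 m) * norm_C x \<theta> \<rho>h W" for U M \<kappa>
  proof -
    have "C_op x \<theta> \<rho>h (dt_bar t U m) j + A_op x \<theta> bh ch (t_avg \<sigma> U m) j = F0 m j + dx_hat x (F1 m) j"
      if "m \<ge> 1" "j \<ge> 1" for m j
      using sol assms(29) that by (simp add: scheme_solution_def)
    moreover have "U 0 = U\<^sub>h" "\<And>m. U m \<in> H_space"
      using sol by (auto simp: scheme_solution_def)
    ultimately show ?thesis
      using parabolic_mesh.a_priori_bound[OF mesh[OF that(2)] \<tau> that(1) _ F01 _ that(3) \<kappa>,
          where U = U and M = M]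
      by (simp only:)
  qed
  show ?thesis
  proof (intro conjI impI allI)
    assume *: "\<sigma> \<ge> 0 \<and> \<theta> \<le> 1 / 4 \<and> \<not> (\<sigma> = 0 \<and> \<theta> = 1 / 4)"
    then have \<sigma>: "0 \<le> \<sigma>" "\<theta> \<le> 1 / 4" "\<not> (\<sigma> = 0 \<and> \<theta> = 1 / 4)"
      by auto
    obtain U where U: "scheme_solution x t \<sigma> \<theta> \<rho>h bh ch F U\<^sub>h U \<and> (\<forall>m. U m \<in> H_space)"
      using parabolic_mesh.scheme_solution_exists[OF mesh[OF \<sigma>(2)] \<tau> \<sigma>(1,3) assms(30) F] ..
    show "\<exists>!U. scheme_solution x t \<sigma> \<theta> \<rho>h bh ch F U\<^sub>h U \<and> (\<forall>m. U m \<in> H_space)"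
    proof (rule ex1I)
      show "scheme_solution x t \<sigma> \<theta> \<rho>h bh ch F U\<^sub>h U \<and> (\<forall>m. U m \<in> H_space)"
        by (rule U)
    next
      fix V
      assume "scheme_solution x t \<sigma> \<theta> \<rho>h bh ch F U\<^sub>h V \<and> (\<forall>m. V m \<in> H_space)"
      with U show "V = U"
        by (intro unique[OF \<sigma>(1,2)]) auto
    qed
  next
    assume "\<sigma> \<ge> 0 \<and> \<theta> \<le> 1 / 4"
    then have \<sigma>: "0 \<le> \<sigma>" "\<theta> \<le> 1 / 4"
      by auto
    show "\<exists>\<^sub>\<le>\<^sub>1U. scheme_solution x t \<sigma> \<theta> \<rho>h bh ch F U\<^sub>h U \<and> (\<forall>m. U m \<in> H_space)"
      by (intro Uniq_I unique[OF \<sigma>]) auto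
  next
    fix U and M :: nat
    assume *: "\<sigma> \<ge> 1 / 2 \<and> \<theta> < 1 / 4"
      and sol: "scheme_solution x t \<sigma> \<theta> \<rho>h bh ch F U\<^sub>h U \<and> (\<forall>m. U m \<in> H_space)"
    then have \<theta>: "\<theta> \<le> 1 / 4" "\<theta> < 1 / 4"
      by auto
    let ?\<kappa> = "1 / sqrt (c_const \<theta> * \<rho>_low)"
    have "\<bar>inner_H x (F0 m) W\<bar> \<le> ?\<kappa> * norm_H x (F0 m) * norm_C x \<theta> \<rho>h W"
      if "m \<ge> 1" "W \<in> H_space" for m W
    proof -
      have "\<bar>inner_H x (F0 m) W\<bar> \<le> norm_H x (F0 m) * norm_H x W"
        using that by (intro inner_H_le F01) (simp_all add: H_space_iff)
      also have "\<dots> \<le> norm_H x (F0 m) * (?\<kappa> * norm_C x \<theta> \<rho>h W)"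
        by (intro mult_left_mono norm_H_nonneg F01 that
            parabolic_mesh.norm_H_le_norm_C[OF mesh[OF \<theta>(1)] \<theta>(2)])
      finally show ?thesis
        by (simp add: mult_ac)
    qed
    moreover have "0 \<le> ?\<kappa>"
      using * assms(4) by (auto simp: c_const_def max_def)
    ultimately show "max (Max ((\<lambda>m. norm_C x \<theta> \<rho>h (U m)) ` {0..M}))
                (sqrt 2 * norm_1 x t \<sigma> \<theta> \<rho>h bh ch M U)
            \<le> norm_C x \<theta> \<rho>h U\<^sub>h
              + K_const \<sigma> / sqrt (c_const \<theta> * \<rho>_low) * (\<Sum>m=1..M. norm_H x (F0 m) * step t m)
              + sqrt (2 / \<nu>) * sqrt (\<Sum>m=1..M. (norm_Ht x (F1 m))\<^sup>2 * step t m)"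
      using bound[of ?\<kappa> U M] * \<theta>(1) sol by simp
  next
    fix U and M :: nat
    assume *: "\<sigma> \<ge> 1 / 2 \<and> \<theta> = 1 / 4 \<and> (\<forall>m\<ge>1. \<forall>j. F0 m j = 0)"
      and sol: "scheme_solution x t \<sigma> \<theta> \<rho>h bh ch F U\<^sub>h U \<and> (\<forall>m. U m \<in> H_space)"
    then have zero: "\<bar>inner_H x (F0 m) W\<bar> \<le> 0 * norm_H x (F0 m) * norm_C x \<theta> \<rho>h W" if "m \<ge> 1" for m W
      using that by (simp add: inner_H_def)
    have *: "\<sigma> \<ge> 1 / 2" "\<theta> \<le> 1 / 4"
      using * by auto
    show "max (Max ((\<lambda>m. norm_C x \<theta> \<rho>h (U m)) ` {0..M}))
                (sqrt 2 * norm_1 x t \<sigma> \<theta> \<rho>h bh ch M U)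
            \<le> norm_C x \<theta> \<rho>h U\<^sub>h
              + sqrt (2 / \<nu>) * sqrt (\<Sum>m=1..M. (norm_Ht x (F1 m))\<^sup>2 * step t m)"
      using bound[OF * order_refl sol zero, of M] by simp
  qed
qed

end
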